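(* Among the distributions $\mathcal{B}_A$, $A\in\mathrm{GL}(2d,\mathbb{R})$, that belong to the Cohen's class, the only ones satisfying the strong support property (i.e. both the time strong support property and the frequency strong support property) are the Rihaczek distribution and the conjugate-Rihaczek distribution.
   Context: For $A\in\mathrm{GL}(2d,\mathbb{R})$ with $d\times d$ blocks $A_{ij}$, $\mathcal{B}_A(f,g)(x,\omega)=\int_{\mathbb{R}^d}e^{-2\pi i\omega\cdot y}f(A_{11}x+A_{12}y)\overline{g(A_{21}x+A_{22}y)}\,dy$ and $\mathcal{B}_Af=\mathcal{B}_A(f,f)$. $\mathcal{B}_A$ belongs to the Cohen's class if there is $\theta\in\mathcal{S}'(\mathbb{R}^{2d})$ with $\mathcal{B}_A(f,g)=W(f,g)*\theta$ for all $f,g\in\mathcal{S}(\mathbb{R}^d)$, where $W(f,g)(x,\omega)=\int_{\mathbb{R}^d}e^{-2\pi iy\cdot\omega}f(x+\tfrac12y)\overline{g(x-\tfrac12y)}\,dy$. The Rihaczek distribution is $\mathcal{B}_{A}$ with $A=\begin{pmatrix}I&0 \\ I&-I\end{pmatrix}$, i.e. $(f,g)\mapsto e^{-2\pi ix\cdot\omega}f(x)\overline{\hat g(\omega)}$; the conjugate-Rihaczek distribution is $\mathcal{B}_{A}$ with $A=\begin{pmatrix}I&I \\ I&0\end{pmatrix}$. Here $\hat f(\omega)=\int e^{-2\pi ix\cdot\omega}f(x)\,dx$. A distribution $Q$, $f\mapsto Qf$, satisfies the time strong support property if for every signal $f\in\mathcal{S}(\mathbb{R}^d)$ and every $x\in\mathbb{R}^d$: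 $f(x)=0\Leftrightarrow Qf(x,\omega)=0$ for all $\omega\in\mathbb{R}^d$. It satisfies the frequency strong support property if for every $f\in\mathcal{S}(\mathbb{R}^d)$ and every $\omega\in\mathbb{R}^d$: $\hat f(\omega)=0\Leftrightarrow Qf(x,\omega)=0$ for all $x\in\mathbb{R}^d$. *)

theory Defs
  imports "HOL-Analysis.Analysis"
begin

text \<open>Iterated partial derivatives: a list of basis vectors plays the role of a multi-index,
  its head being the direction of the outermost derivative.\<close>

fun iter_deriv :: "'a list \<Rightarrow> ('a::euclidean_space \<Rightarrow> complex) \<Rightarrow> 'a \<Rightarrow> complex" where
  "iter_deriv [] f = f"
| "iter_deriv (b # bs) f = (\<lambda>x. frechet_derivative (iter_deriv bs f) (at x) b)"

text \<open>Differentiability of all iterated partial derivatives makes \<open>f\<close> smooth (and rules out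
  the arbitrary value of \<^const>\<open>frechet_derivative\<close> at points of non-differentiability).\<close>

definition schwartz :: "('a::euclidean_space \<Rightarrow> complex) set" where
  "schwartz = {f. \<forall>bs. set bs \<subseteq> Basis \<longrightarrow>
     (\<forall>x. iter_deriv bs f differentiable at x) \<and>
     (\<forall>k::nat. bounded (range (\<lambda>x. norm x ^ k * norm (iter_deriv bs f x))))}"

definition schwartz_seminorm ::
    "nat \<Rightarrow> 'a list \<Rightarrow> ('a::euclidean_space \<Rightarrow> complex) \<Rightarrow> real" where
  "schwartz_seminorm k bs f = (SUP x. norm x ^ k * norm (iter_deriv bs f x))"

definition schwartz_converges ::
    "(nat \<Rightarrow> 'a::euclidean_space \<Rightarrow> complex) \<Rightarrow> ('a \<Rightarrow> complex) \<Rightarrow> bool" where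
  "schwartz_converges \<phi> \<psi> \<longleftrightarrow> (\<forall>k bs. set bs \<subseteq> Basis \<longrightarrow>
     (\<lambda>n. schwartz_seminorm k bs (\<lambda>x. \<phi> n x - \<psi> x)) \<longlonglongrightarrow> 0)"

text \<open>The Schwartz space is metrizable, so continuity of a functional is sequential continuity.
  The values of a tempered distribution outside \<^const>\<open>schwartz\<close> are irrelevant.\<close>

definition tempered_distribution ::
    "(('a::euclidean_space \<Rightarrow> complex) \<Rightarrow> complex) \<Rightarrow> bool" where
  "tempered_distribution \<theta> \<longleftrightarrow>
     (\<forall>\<phi>\<in>schwartz. \<forall>\<psi>\<in>schwartz. \<theta> (\<lambda>x. \<phi> x + \<psi> x) = \<theta> \<phi> + \<theta> \<psi>) \<and>
     (\<forall>c. \<forall>\<phi>\<in>schwartz. \<theta> (\<lambda>x. c * \<phi> x) = c * \<theta> \<phi>) \<and>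
     (\<forall>\<phi> \<psi>. (\<forall>n. \<phi> n \<in> schwartz) \<longrightarrow> \<psi> \<in> schwartz \<longrightarrow> schwartz_converges \<phi> \<psi> \<longrightarrow>
        (\<lambda>n. \<theta> (\<phi> n)) \<longlonglongrightarrow> \<theta> \<psi>)"

definition conv_distribution ::
    "('a::euclidean_space \<Rightarrow> complex) \<Rightarrow> (('a \<Rightarrow> complex) \<Rightarrow> complex) \<Rightarrow> 'a \<Rightarrow> complex" where
  "conv_distribution \<phi> \<theta> z = \<theta> (\<lambda>w. \<phi> (z - w))"

text \<open>Phase space, of dimension \<open>2d\<close>, is the type of pairs \<open>(x, \<omega>)\<close>, where \<open>d = CARD('n)\<close>;
  the rows and columns of a \<open>2d \<times> 2d\<close> matrix are indexed by \<open>'n + 'n\<close>, with \<^const>\<open>Inl\<close> for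
  the first \<open>d\<close> of them.\<close>

type_synonym 'n signal = "real^'n \<Rightarrow> complex"
type_synonym 'n phase_fun = "(real^'n) \<times> (real^'n) \<Rightarrow> complex"

definition block11 :: "real^('n::finite + 'n)^('n + 'n) \<Rightarrow> real^'n^'n" where
  "block11 A = (\<chi> i j. A $ Inl i $ Inl j)"
definition block12 :: "real^('n::finite + 'n)^('n + 'n) \<Rightarrow> real^'n^'n" where
  "block12 A = (\<chi> i j. A $ Inl i $ Inr j)"
definition block21 :: "real^('n::finite + 'n)^('n + 'n) \<Rightarrow> real^'n^'n" where
  "block21 A = (\<chi> i j. A $ Inr i $ Inl j)"
definition block22 :: "real^('n::finite + 'n)^('n + 'n) \<Rightarrow> real^'n^'n" where
  "block22 A = (\<chi> i j. A $ Inr i $ Inr j)"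

definition block_matrix ::
    "real^'n^'n \<Rightarrow> real^'n^'n \<Rightarrow> real^'n^'n \<Rightarrow> real^'n^'n \<Rightarrow> real^('n::finite + 'n)^('n + 'n)" where
  "block_matrix P Q R S = (\<chi> i j. case i of
      Inl i' \<Rightarrow> (case j of Inl j' \<Rightarrow> P $ i' $ j' | Inr j' \<Rightarrow> Q $ i' $ j')
    | Inr i' \<Rightarrow> (case j of Inl j' \<Rightarrow> R $ i' $ j' | Inr j' \<Rightarrow> S $ i' $ j'))"

definition fourier :: "'n::finite signal \<Rightarrow> 'n signal" where
  "fourier f \<omega> = (LINT x|lborel. exp (- (2 * of_real pi * \<i> * of_real (x \<bullet> \<omega>))) * f x)"

definition wigner :: "'n::finite signal \<Rightarrow> 'n signal \<Rightarrow> 'n phase_fun" where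
  "wigner f g = (\<lambda>(x, \<omega>). LINT y|lborel.
     exp (- (2 * of_real pi * \<i> * of_real (y \<bullet> \<omega>))) *
     f (x + (1/2) *\<^sub>R y) * cnj (g (x - (1/2) *\<^sub>R y)))"

definition matrix_dist ::
    "real^('n::finite + 'n)^('n + 'n) \<Rightarrow> 'n signal \<Rightarrow> 'n signal \<Rightarrow> 'n phase_fun" where
  "matrix_dist A f g = (\<lambda>(x, \<omega>). LINT y|lborel.
     exp (- (2 * of_real pi * \<i> * of_real (\<omega> \<bullet> y))) *
     f (block11 A *v x + block12 A *v y) * cnj (g (block21 A *v x + block22 A *v y)))"

definition cohen_class :: "('n::finite signal \<Rightarrow> 'n signal \<Rightarrow> 'n phase_fun) \<Rightarrow> bool" where
  "cohen_class B \<longleftrightarrow> (\<exists>\<theta>. tempered_distribution \<theta> \<and>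
     (\<forall>f\<in>schwartz. \<forall>g\<in>schwartz. B f g = conv_distribution (wigner f g) \<theta>))"

definition rihaczek :: "'n::finite signal \<Rightarrow> 'n signal \<Rightarrow> 'n phase_fun" where
  "rihaczek = matrix_dist (block_matrix (mat 1) 0 (mat 1) (- mat 1))"

definition conj_rihaczek :: "'n::finite signal \<Rightarrow> 'n signal \<Rightarrow> 'n phase_fun" where
  "conj_rihaczek = matrix_dist (block_matrix (mat 1) (mat 1) (mat 1) 0)"

definition time_strong_support :: "('n::finite signal \<Rightarrow> 'n phase_fun) \<Rightarrow> bool" where
  "time_strong_support Q \<longleftrightarrow> (\<forall>f\<in>schwartz. \<forall>x. f x = 0 \<longleftrightarrow> (\<forall>\<omega>. Q f (x, \<omega>) = 0))"

definition frequency_strong_support :: "('n::finite signal \<Rightarrow> 'n phase_fun) \<Rightarrow> bool" where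
  "frequency_strong_support Q \<longleftrightarrow>
     (\<forall>f\<in>schwartz. \<forall>\<omega>. fourier f \<omega> = 0 \<longleftrightarrow> (\<forall>x. Q f (x, \<omega>) = 0))"

definition strong_support :: "('n::finite signal \<Rightarrow> 'n phase_fun) \<Rightarrow> bool" where
  "strong_support Q \<longleftrightarrow> time_strong_support Q \<and> frequency_strong_support Q"

lemma block_matrix_blocks [simp]:
  "block11 (block_matrix P Q R S) = P" "block12 (block_matrix P Q R S) = Q"
  "block21 (block_matrix P Q R S) = R" "block22 (block_matrix P Q R S) = S"
  by (simp_all add: block11_def block12_def block21_def block22_def block_matrix_def vec_eq_iff)

lemma schwartz_imp_continuous: "f \<in> schwartz \<Longrightarrow> continuous_on UNIV f"
  unfolding schwartz_def continuous_on_eq_continuous_at[OF open_UNIV]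
  by (auto dest!: spec[of _ "[]"] intro: differentiable_imp_continuous_within)

lemma rihaczek_eq:
  fixes f g :: "'n::finite signal"
  assumes "g \<in> schwartz"
  shows "rihaczek f g (x, \<omega>) =
    exp (- (2 * of_real pi * \<i> * of_real (x \<bullet> \<omega>))) * f x * cnj (fourier g \<omega>)"
proof -
  let ?e = "\<lambda>t::real. exp (- (2 * of_real pi * \<i> * of_real t))"
  define h where "h y = ?e (\<omega> \<bullet> y) * f x * cnj (g (x - y))" for y
  have g: "continuous_on UNIV g"
    by (rule schwartz_imp_continuous[OF assms])
  have "continuous_on UNIV h"
    unfolding h_def by (intro continuous_intros continuous_on_compose2[OF g]) auto
  then have meas: "h \<in> borel_measurable borel"
    by (rule borel_measurable_continuous_onI)
  have neg: "(- mat 1 :: real^'n^'n) *v y = - y" for y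
    by (simp add: matrix_vector_mult_def mat_def vec_eq_iff if_distrib if_distribR sum_negf
        cong: if_cong)
  have "rihaczek f g (x, \<omega>) = (LINT y|lborel. h y)"
    by (simp add: rihaczek_def matrix_dist_def h_def neg)
  also have "\<dots> = (LINT u|lborel. h (x - u))"
    by (subst lborel_affine[of "-1" x])
      (simp_all add: integral_density integral_distr meas density_1)
  also have "\<dots> = (LINT u|lborel. (?e (x \<bullet> \<omega>) * f x) * cnj (?e (u \<bullet> \<omega>) * g u))"
    by (intro Bochner_Integration.integral_cong refl)
      (simp add: h_def inner_diff_right inner_commute exp_cnj algebra_simps flip: exp_add)
  also have "\<dots> = ?e (x \<bullet> \<omega>) * f x * cnj (fourier g \<omega>)"
    by (simp only: fourier_def integral_mult_right_zero Bochner_Integration.integral_cnj)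
  finally show ?thesis .
qed

end

theory Submission
  imports Defs "HOL-Probability.Characteristic_Functions" "HOL-Probability.Sinc_Integral"
begin

text \<open>Membership in the Cohen class makes a distribution covariant under time shifts and modulations,
  because the Wigner distribution is covariant and convolution commutes with translations. For
  \<open>matrix_dist A\<close> this forces the blocks \<open>A11 = A21 = 1\<close> and \<open>A12 - A22 = 1\<close>
  (\<open>cohen_class_time_blocks\<close>, \<open>cohen_class_frequency_blocks\<close>): tested on Gaussian wave packets, any
  defect shows up as a nontrivial phase multiplying the integral of a positive function. So the
  distribution has the form of the integral of
  \<open>exp (- 2 \<pi> i \<omega> \<bullet> y) f (x + P y) cnj (f (x + P y - y))\<close> for a single matrix \<open>P\<close>.

  For a signal that vanishes at the origin only and is positive elsewhere, the time strong support
  property at \<open>x = 0\<close>, read at \<open>\<omega> = 0\<close>, says that the integral of a non-negative function is zero. Hence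
  \<open>P y = 0\<close> or \<open>P y = y\<close> for every \<open>y\<close> (\<open>time_strong_support_blocks\<close>), and since a vector space is not the
  union of two proper subspaces, \<open>P = 0\<close> or \<open>P = 1\<close>. These are the Rihaczek and the conjugate-Rihaczek
  distributions.

  Conversely, the two distributions are obtained from the Wigner distribution by convolution with
  the chirps \<open>2 ^ d * exp (\<mp> 4 \<pi> i x \<bullet> \<omega>)\<close>: integrating over \<open>\<omega>\<close> inverts the Fourier transform in the Wigner
  distribution and evaluates the product \<open>f (x + y/2) * cnj (g (x - y/2))\<close> at a lag \<open>y\<close> proportional
  to the remaining integration variable (\<open>chirp_distribution_wigner\<close>). The inversion is made rigorous by a
  Gaussian cut-off (\<open>regularised_fourier_inversion\<close>), which also yields the injectivity of the
  Fourier transform. Strong support then follows, since up to a phase and a complex conjugation both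
  distributions are the product \<open>f x * cnj (fourier f \<omega>)\<close>, and \<open>f\<close> vanishes identically as soon as its transform does.\<close>

section \<open>The Fourier kernel\<close>

text \<open>Writing the phase factor as a function of its real argument turns the manipulation of Fourier
  kernels into the single rule \<open>wave_add\<close>. The sign is the one of the forward transform.\<close>

definition wave :: "real \<Rightarrow> complex" where
  "wave t = exp (- (2 * of_real pi * \<i> * of_real t))"

lemma norm_wave [simp]: "norm (wave t) = 1"
  by (simp add: wave_def norm_exp_eq_Re)

lemma wave_0 [simp]: "wave 0 = 1"
  by (simp add: wave_def)

lemma wave_add: "wave (s + t) = wave s * wave t"
  by (simp add: wave_def algebra_simps flip: exp_add)

lemma cnj_wave: "cnj (wave t) = wave (- t)"
  by (simp add: wave_def exp_cnj)

lemma wave_half: "wave (1/2) = -1"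
  by (simp add: wave_def exp_minus)

lemma Re_wave: "Re (wave t) = cos (2 * pi * t)"
  by (simp add: wave_def Re_exp)

lemma continuous_on_wave [continuous_intros]:
  "continuous_on S f \<Longrightarrow> continuous_on S (\<lambda>x. wave (f x))"
  unfolding wave_def by (intro continuous_intros)

lemma wave_measurable [measurable]: "wave \<in> borel_measurable borel"
  by (intro borel_measurable_continuous_onI continuous_intros)

section \<open>Wave packets are Schwartz functions\<close>

text \<open>Complex polynomials on a Euclidean space, generated from the coordinate functionals so that
  stability under directional derivatives and polynomial growth are inductions.\<close>

inductive cpoly :: "('a::euclidean_space \<Rightarrow> complex) \<Rightarrow> bool" where
  const: "cpoly (\<lambda>x. c)"
| inner: "cpoly (\<lambda>x. of_real (x \<bullet> b))"
| add: "cpoly p \<Longrightarrow> cpoly q \<Longrightarrow> cpoly (\<lambda>x. p x + q x)"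
| mult: "cpoly p \<Longrightarrow> cpoly q \<Longrightarrow> cpoly (\<lambda>x. p x * q x)"

lemma cpoly_has_derivative:
  assumes "cpoly p"
  shows "\<exists>p'. \<forall>x. (p has_derivative p' x) (at x) \<and> (\<forall>b. cpoly (\<lambda>x. p' x b))"
  using assms
proof induction
  case (const c)
  show ?case
    by (intro exI[of _ "\<lambda>_ _. 0"] allI conjI has_derivative_const cpoly.const)
next
  case (inner b)
  show ?case
    by (intro exI[of _ "\<lambda>_ h. of_real (h \<bullet> b)"] allI conjI cpoly.const) (auto intro!: derivative_eq_intros)
next
  case (add p q)
  then obtain p' q' where "\<forall>x. (p has_derivative p' x) (at x) \<and> (\<forall>b. cpoly (\<lambda>x. p' x b))"
    "\<forall>x. (q has_derivative q' x) (at x) \<and> (\<forall>b. cpoly (\<lambda>x. q' x b))" by blast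
  then show ?case
    by (intro exI[of _ "\<lambda>x h. p' x h + q' x h"])
      (auto intro!: derivative_eq_intros cpoly.add)
next
  case (mult p q)
  then obtain p' q' where d: "\<forall>x. (p has_derivative p' x) (at x) \<and> (\<forall>b. cpoly (\<lambda>x. p' x b))"
    "\<forall>x. (q has_derivative q' x) (at x) \<and> (\<forall>b. cpoly (\<lambda>x. q' x b))" by blast
  have "((\<lambda>x. p x * q x) has_derivative (\<lambda>h. p x * q' x h + p' x h * q x)) (at x)" for x
    using d by (intro has_derivative_mult) auto
  with d mult.hyps show ?case
    by (intro exI[of _ "\<lambda>x h. p x * q' x h + p' x h * q x"])
      (auto intro!: cpoly.add cpoly.mult)
qed

lemma cpoly_growth:
  assumes "cpoly p"
  shows "\<exists>C n. \<forall>x. norm (p x) \<le> C * (1 + norm x) ^ n"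
  using assms
proof induction
  case (const c)
  show ?case by (intro exI[of _ "norm c"] exI[of _ 0]) simp
next
  case (inner b)
  have "norm (of_real (x \<bullet> b) :: complex) \<le> norm b * (1 + norm x) ^ 1" for x
    using Cauchy_Schwarz_ineq2[of x b] norm_ge_zero[of b] by (simp add: algebra_simps add_increasing)
  then show ?case by blast
next
  case (add p q)
  then obtain C m D n where p: "\<And>x. norm (p x) \<le> C * (1 + norm x) ^ m"
    and q: "\<And>x. norm (q x) \<le> D * (1 + norm x) ^ n" by blast
  have "norm (p x + q x) \<le> (\<bar>C\<bar> + \<bar>D\<bar>) * (1 + norm x) ^ (m + n)" for x
  proof -
    have "C * (1 + norm x) ^ m \<le> \<bar>C\<bar> * (1 + norm x) ^ (m + n)"
      by (intro mult_mono power_increasing) auto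
    moreover have "D * (1 + norm x) ^ n \<le> \<bar>D\<bar> * (1 + norm x) ^ (m + n)"
      by (intro mult_mono power_increasing) auto
    ultimately show ?thesis
      using p[of x] q[of x] norm_triangle_ineq[of "p x" "q x"] by (simp add: algebra_simps)
  qed
  then show ?case by blast
next
  case (mult p q)
  then obtain C m D n where p: "\<And>x. norm (p x) \<le> C * (1 + norm x) ^ m"
    and q: "\<And>x. norm (q x) \<le> D * (1 + norm x) ^ n" by blast
  have "norm (p x * q x) \<le> (C * D) * (1 + norm x) ^ (m + n)" for x
    using mult_mono'[OF p[of x] q[of x]] by (simp add: norm_mult power_add algebra_simps)
  then show ?case by blast
qed

text \<open>The Gaussian centred at \<open>c\<close> and modulated by the frequency \<open>a\<close>; the inner minus sign produces
  \<open>exp (2 \<pi> i t \<bullet> a)\<close>. Translations and modulations map the family to itself up to constants, which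
  makes it a convenient supply of signals for testing covariance.\<close>

definition wave_packet :: "'a::euclidean_space \<Rightarrow> 'a \<Rightarrow> 'a \<Rightarrow> complex" where
  "wave_packet a c t = wave (- (t \<bullet> a)) * of_real (exp (- (norm (t - c))\<^sup>2))"

lemma wave_packet_has_derivative:
  "(wave_packet a c has_derivative
     (\<lambda>h. (of_real (2 * pi * (h \<bullet> a)) * \<i> + of_real (2 * (h \<bullet> c)) + (-2) * of_real (t \<bullet> h)) * wave_packet a c t)) (at t)"
proof -
  have eq: "wave_packet a c = (\<lambda>t. exp (of_real (t \<bullet> ((2*pi) *\<^sub>R a)) * \<i> - of_real ((t - c) \<bullet> (t - c))))"
    by (auto simp: wave_packet_def wave_def power2_norm_eq_inner exp_of_real[symmetric] algebra_simps simp flip: exp_add)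
  have "((\<lambda>t. of_real (t \<bullet> ((2*pi) *\<^sub>R a)) * \<i> - of_real ((t - c) \<bullet> (t - c)) :: complex) has_derivative
      (\<lambda>h. of_real (h \<bullet> ((2*pi) *\<^sub>R a)) * \<i> - of_real ((t - c) \<bullet> h + h \<bullet> (t - c)))) (at t)"
    by (auto intro!: derivative_eq_intros)
  from has_derivative_compose[OF this DERIV_exp[unfolded has_field_derivative_def]] show ?thesis unfolding eq
    by (rule has_derivative_eq_rhs) (simp add: algebra_simps inner_commute)
qed

text \<open>The logarithmic derivative of a wave packet is a polynomial of degree one, so every iterated
  derivative keeps the form polynomial times the same wave packet.\<close>

lemma iter_deriv_wave_packet:
  assumes "cpoly p"
  shows "\<exists>q. cpoly q \<and> iter_deriv bs (\<lambda>t. p t * wave_packet a c t) = (\<lambda>t. q t * wave_packet a c t)"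
proof (induction bs)
  case Nil
  then show ?case using assms by auto
next
  case (Cons b bs)
  then obtain q where q: "cpoly q" and eq: "iter_deriv bs (\<lambda>t. p t * wave_packet a c t) = (\<lambda>t. q t * wave_packet a c t)"
    by blast
  obtain q' where q': "\<And>x. (q has_derivative q' x) (at x)" "\<And>b. cpoly (\<lambda>x. q' x b)"
    using cpoly_has_derivative[OF q] by blast
  define r where "r t = q t * (of_real (2 * pi * (b \<bullet> a)) * \<i> + of_real (2 * (b \<bullet> c)) + (-2) * of_real (t \<bullet> b)) + q' t b" for t
  have "cpoly r" unfolding r_def
    by (intro cpoly.intros q q')
  moreover have "frechet_derivative (\<lambda>t. q t * wave_packet a c t) (at t) b = r t * wave_packet a c t" for t
    using frechet_derivative_at[OF has_derivative_mult[OF q'(1) wave_packet_has_derivative[of a c]], of t, symmetric]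
    by (simp add: r_def algebra_simps)
  ultimately show ?case by (auto simp: eq)
qed

text \<open>A polynomial weight costs at most a factor \<open>(1 + norm x) ^ m \<le> exp (m * norm x)\<close>, and completing
  the square shows that the Gaussian absorbs it.\<close>

lemma poly_wave_packet_schwartz:
  assumes "cpoly p"
  shows "(\<lambda>t. p t * wave_packet a c t) \<in> schwartz"
  unfolding schwartz_def mem_Collect_eq
proof (intro allI impI conjI)
  fix bs :: "'a list"
  obtain q where q: "cpoly q" and eq: "iter_deriv bs (\<lambda>t. p t * wave_packet a c t) = (\<lambda>t. q t * wave_packet a c t)"
    using iter_deriv_wave_packet[OF assms] by blast
  show "iter_deriv bs (\<lambda>t. p t * wave_packet a c t) differentiable at x" for x
    using cpoly_has_derivative[OF q] has_derivative_mult[OF _ wave_packet_has_derivative[of a c x]]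
    unfolding eq differentiable_def by meson
  fix k :: nat
  obtain C n where C: "\<And>x. norm (q x) \<le> C * (1 + norm x) ^ n"
    using cpoly_growth[OF q] by blast
  define m where "m = real (n + k)"
  have "norm x ^ k * norm (q x * wave_packet a c x) \<le> C * exp (m * norm c + m\<^sup>2)" for x
  proof -
    have "0 \<le> C" using C[of 0] order_trans[OF norm_ge_zero] by fastforce
    let ?r = "1 + norm x" and ?s = "norm (x - c)"
    have "norm x ^ k * norm (q x * wave_packet a c x) \<le> ?r ^ k * ((C * ?r ^ n) * exp (- ?s\<^sup>2))"
      unfolding norm_mult wave_packet_def
      by (intro mult_mono power_mono C) (use C[of x] order_trans[OF norm_ge_zero C[of x]] in auto)
    also have "\<dots> = C * (?r ^ (n + k) * exp (- ?s\<^sup>2))"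
      by (simp add: power_add algebra_simps)
    also have "\<dots> \<le> C * (exp (norm x) ^ (n + k) * exp (- ?s\<^sup>2))"
      using \<open>0 \<le> C\<close> by (intro mult_left_mono mult_right_mono power_mono exp_ge_add_one_self) auto
    also have "\<dots> = C * exp (m * norm x - ?s\<^sup>2)"
      by (simp add: m_def exp_diff exp_minus field_simps flip: exp_of_nat_mult)
    also have "\<dots> \<le> C * exp (m * norm c + m\<^sup>2)"
    proof -
      have "norm x \<le> norm c + ?s" using norm_triangle_ineq[of c "x - c"] by simp
      then have "m * norm x \<le> m * (norm c + ?s)"
        by (rule mult_left_mono) (simp add: m_def)
      moreover have "m * ?s - ?s\<^sup>2 = m\<^sup>2 / 4 - (?s - m / 2)\<^sup>2"
        by (simp add: power2_eq_square field_simps)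
      then have "m * ?s - ?s\<^sup>2 \<le> m\<^sup>2"
        using zero_le_power2[of m] zero_le_power2[of "?s - m / 2"] by linarith
      ultimately show ?thesis
        using \<open>0 \<le> C\<close> by (simp add: algebra_simps mult_left_mono)
    qed
    finally show ?thesis .
  qed
  then show "bounded (range (\<lambda>x. norm x ^ k * norm (iter_deriv bs (\<lambda>t. p t * wave_packet a c t) x)))"
    unfolding eq bounded_iff by (auto simp: abs_mult norm_mult)
qed

lemma cpoly_sum: "(\<And>i. i \<in> I \<Longrightarrow> cpoly (p i)) \<Longrightarrow> cpoly (\<lambda>x. \<Sum>i\<in>I. p i x)"
  by (induction I rule: infinite_finite_induct) (simp_all add: cpoly.intros)

lemma cpoly_norm_square: "cpoly (\<lambda>x. of_real ((norm x)\<^sup>2))"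
proof -
  have "cpoly (\<lambda>x. \<Sum>b\<in>Basis. of_real (x \<bullet> b) * of_real (x \<bullet> b))"
    by (intro cpoly_sum cpoly.intros)
  then show ?thesis
    unfolding power2_norm_eq_inner euclidean_inner[of x x for x] by simp
qed

lemma scaled_wave_packet_schwartz: "(\<lambda>t. k * wave_packet a c t) \<in> schwartz"
  by (intro poly_wave_packet_schwartz cpoly.const)

lemma wave_packet_schwartz: "wave_packet a c \<in> schwartz"
  using scaled_wave_packet_schwartz[of 1 a c] by simp

lemma translated_wave_packet_schwartz: "(\<lambda>t. wave_packet a c (t + u)) \<in> schwartz"
proof -
  have "wave_packet a c (t + u) = wave (- (u \<bullet> a)) * wave_packet a (c - u) t" for t
    using wave_add[of "- (t \<bullet> a)" "- (u \<bullet> a)"]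
    by (simp add: wave_packet_def inner_add_left algebra_simps)
  then show ?thesis
    using scaled_wave_packet_schwartz by simp
qed

section \<open>Gaussian integrals and regularised Fourier inversion\<close>

text \<open>Lebesgue measure is the image of a product of one-dimensional measures, which reduces Gaussian
  integrals and the integrability of decay weights to dimension one.\<close>

lemma
  fixes u :: "'a::euclidean_space \<Rightarrow> real \<Rightarrow> 'b::{real_normed_field,banach,second_countable_topology}"
  assumes u: "\<And>b. b \<in> Basis \<Longrightarrow> integrable lborel (u b)"
  shows lborel_integrable_prod: "integrable lborel (\<lambda>x::'a. \<Prod>b\<in>Basis. u b (x \<bullet> b))"
    and lborel_integral_prod:
      "(LINT x|lborel. (\<Prod>b\<in>Basis. u b (x \<bullet> b))) = (\<Prod>b\<in>Basis. (LINT t|lborel. u b t))"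
proof -
  interpret product_sigma_finite "\<lambda>_::'a. lborel :: real measure" ..
  have [measurable]: "u b \<in> borel_measurable borel" if "b \<in> Basis" for b
    using u[OF that] by simp
  show "integrable lborel (\<lambda>x::'a. \<Prod>b\<in>Basis. u b (x \<bullet> b))"
    by (subst lborel_eq, subst integrable_distr_eq)
      (auto intro!: product_integrable_prod u cong: prod.cong)
  show "(LINT x|lborel. (\<Prod>b\<in>Basis. u b (x \<bullet> b))) = (\<Prod>b\<in>Basis. (LINT t|lborel. u b t))"
    by (subst lborel_eq, subst integral_distr)
      (auto intro!: product_integral_prod u cong: prod.cong)
qed

text \<open>Stated for arbitrary \<open>f\<close>: a function and its affine substitution are integrable together, so both
  integrals take the default value 0 together.\<close>

lemma
  fixes f :: "'a::euclidean_space \<Rightarrow> complex"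
  assumes c: "c \<noteq> 0"
  shows lborel_integral_affine:
      "(LINT x|lborel. f x) = of_real (\<bar>c\<bar> ^ DIM('a)) * (LINT x|lborel. f (t + c *\<^sub>R x))"
    and lborel_integrable_affine:
      "integrable lborel f \<Longrightarrow> integrable lborel (\<lambda>x. f (t + c *\<^sub>R x))"
proof -
  have density: "lborel = density (distr lborel borel (\<lambda>x. t + c *\<^sub>R x)) (\<lambda>_. \<bar>c\<bar> ^ DIM('a))"
    using lborel_affine[OF c, of t] by simp
  show "(LINT x|lborel. f x) = of_real (\<bar>c\<bar> ^ DIM('a)) * (LINT x|lborel. f (t + c *\<^sub>R x))"
  proof (cases "f \<in> borel_measurable borel")
    case True
    then show ?thesis
      by (subst density, subst integral_density) (auto simp: integral_distr scaleR_conv_of_real)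
  next
    case False
    have "(\<lambda>x. f (t + c *\<^sub>R x)) \<notin> borel_measurable borel"
    proof
      assume "(\<lambda>x. f (t + c *\<^sub>R x)) \<in> borel_measurable borel"
      then have "(\<lambda>y. f (t + c *\<^sub>R ((1 / c) *\<^sub>R (y - t)))) \<in> borel_measurable borel"
        by (rule measurable_compose[rotated]) measurable
      with False c show False by simp
    qed
    with False have "\<not> integrable lborel f" "\<not> integrable lborel (\<lambda>x. f (t + c *\<^sub>R x))"
      using borel_measurable_integrable by fastforce+
    then show ?thesis by (simp add: not_integrable_integral_eq)
  qed
  assume int: "integrable lborel f"
  then have [measurable]: "f \<in> borel_measurable borel" by simp
  from int have "integrable (density (distr lborel borel (\<lambda>x. t + c *\<^sub>R x)) (\<lambda>_. \<bar>c\<bar> ^ DIM('a))) f"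
    using density by simp
  then show "integrable lborel (\<lambda>x. f (t + c *\<^sub>R x))"
    using c integrable_scaleR_right[of "inverse (\<bar>c\<bar> ^ DIM('a))" lborel "\<lambda>x. \<bar>c\<bar> ^ DIM('a) *\<^sub>R f (t + c *\<^sub>R x)"]
    by (subst (asm) integrable_density) (auto simp: integrable_distr_eq)
qed

text \<open>The characteristic function of the standard normal distribution, rescaled by \<open>sqrt (2 * pi)\<close> so that
  the Gaussian becomes its own Fourier transform.\<close>

lemma
  shows integrable_wave_gauss_real:
      "integrable lborel (\<lambda>t. wave (t * s) * of_real (exp (- pi * t\<^sup>2)))"
    and integral_wave_gauss_real:
      "(LINT t|lborel. wave (t * s) * of_real (exp (- pi * t\<^sup>2))) = of_real (exp (- pi * s\<^sup>2))"
proof -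
  define r where "r = sqrt (2 * pi)"
  have r: "r > 0" "r * r = 2 * pi" by (simp_all add: r_def)
  define h where "h x = std_normal_density x *\<^sub>R iexp (- (r * s) * x)" for x
  have eq: "h (0 + r * t) = of_real (1 / r) * (wave (t * s) * of_real (exp (- pi * t\<^sup>2)))" for t
  proof -
    have 1: "iexp (- (r * s) * (0 + r * t)) = wave (t * s)"
    proof -
      have "- (r * s) * (0 + r * t) = - (2 * pi * (t * s))"
        unfolding r(2)[symmetric] by (simp add: ac_simps)
      moreover have "iexp (- (2 * pi * (t * s))) = wave (t * s)"
        by (simp add: wave_def ac_simps)
      ultimately show ?thesis by presburger
    qed
    have 2: "std_normal_density (0 + r * t) = (1 / r) * exp (- pi * t\<^sup>2)"
    proof -
      have "- (0 + r * t)\<^sup>2 / 2 = - pi * t\<^sup>2"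
        using r(2) by (simp add: power_mult_distrib power2_eq_square[of r])
      then show ?thesis unfolding std_normal_density_def r_def[symmetric] by simp
    qed
    show ?thesis unfolding h_def 1 2 by (simp add: scaleR_conv_of_real)
  qed
  have "integrable std_normal_distribution (\<lambda>x. iexp (- (r * s) * x))"
    by (rule real_distribution.axioms(1)[OF real_dist_normal_dist, THEN prob_space.integrable_iexp]) auto
  then have int: "integrable lborel h"
    unfolding h_def by (subst (asm) integrable_density) auto
  have "integrable lborel (\<lambda>t. of_real (1 / r) * (wave (t * s) * of_real (exp (- pi * t\<^sup>2))))"
    using lborel_integrable_real_affine[OF int, of r 0] r unfolding eq by blast
  then have "integrable lborel (\<lambda>t. of_real r * (of_real (1 / r) * (wave (t * s) * of_real (exp (- pi * t\<^sup>2)))))"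
    by (rule integrable_mult_right)
  moreover have "of_real r * (of_real (1 / r) * z) = z" for z :: complex
    using r by simp
  ultimately show "integrable lborel (\<lambda>t. wave (t * s) * of_real (exp (- pi * t\<^sup>2)))"
    by (simp only:)
  have "of_real (exp (- pi * s\<^sup>2)) = char std_normal_distribution (- (r * s))"
    using r(2) by (simp add: char_std_normal_distribution power2_eq_square algebra_simps)
  also have "\<dots> = (LINT x|lborel. h x)"
    unfolding char_def h_def by (subst integral_density) auto
  also have "\<dots> = \<bar>r\<bar> *\<^sub>R (LINT t|lborel. h (0 + r * t))"
    using r by (intro lborel_integral_real_affine) auto
  also have "\<dots> = (LINT t|lborel. wave (t * s) * of_real (exp (- pi * t\<^sup>2)))"
    unfolding eq using r by (simp add: scaleR_conv_of_real)
  finally show "(LINT t|lborel. wave (t * s) * of_real (exp (- pi * t\<^sup>2))) = of_real (exp (- pi * s\<^sup>2))" ..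
qed

lemma wave_sum: "wave (\<Sum>i\<in>I. f i) = (\<Prod>i\<in>I. wave (f i))"
  by (induction I rule: infinite_finite_induct) (simp_all add: wave_add)

lemma
  fixes v :: "'a::euclidean_space"
  shows integrable_wave_gauss:
      "integrable lborel (\<lambda>x. wave (x \<bullet> v) * of_real (exp (- pi * (norm x)\<^sup>2)))"
    and integral_wave_gauss:
      "(LINT x|lborel. wave (x \<bullet> v) * of_real (exp (- pi * (norm x)\<^sup>2))) = of_real (exp (- pi * (norm v)\<^sup>2))"
proof -
  have norm: "exp (- pi * (norm x)\<^sup>2) = (\<Prod>b\<in>Basis. exp (- pi * (x \<bullet> b)\<^sup>2))" for x :: 'a
  proof -
    have "(norm x)\<^sup>2 = (\<Sum>b\<in>Basis. (x \<bullet> b)\<^sup>2)"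
      unfolding power2_norm_eq_inner euclidean_inner[of x x] by (simp add: power2_eq_square)
    then show ?thesis by (simp add: sum_distrib_left exp_sum flip: sum_negf)
  qed
  have eq: "wave (x \<bullet> v) * of_real (exp (- pi * (norm x)\<^sup>2))
    = (\<Prod>b\<in>Basis. wave ((x \<bullet> b) * (v \<bullet> b)) * of_real (exp (- pi * (x \<bullet> b)\<^sup>2)))" for x
    unfolding norm by (simp add: euclidean_inner[of x v] wave_sum prod.distrib)
  show "integrable lborel (\<lambda>x. wave (x \<bullet> v) * of_real (exp (- pi * (norm x)\<^sup>2)))"
    unfolding eq by (intro lborel_integrable_prod integrable_wave_gauss_real)
  show "(LINT x|lborel. wave (x \<bullet> v) * of_real (exp (- pi * (norm x)\<^sup>2))) = of_real (exp (- pi * (norm v)\<^sup>2))"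
    unfolding eq norm[of v]
    by (subst lborel_integral_prod) (simp_all add: integrable_wave_gauss_real[simplified] integral_wave_gauss_real[simplified])
qed

lemma integrable_gauss:
  assumes "k > 0"
  shows "integrable lborel (\<lambda>x::'a::euclidean_space. complex_of_real (exp (- k * (norm x)\<^sup>2)))"
proof -
  let ?g = "\<lambda>x::'a. complex_of_real (exp (- pi * (norm x)\<^sup>2))"
  define c where "c = sqrt (k / pi)"
  have c: "c \<noteq> 0" "c\<^sup>2 = k / pi" using assms by (simp_all add: c_def)
  have "integrable lborel ?g" using integrable_wave_gauss[of 0] by simp
  from lborel_integrable_affine[OF c(1) this, of 0] show ?thesis
    using c by (simp add: power_mult_distrib)
qed

text \<open>Exchanging the integrals replaces the Gaussian cut-off in frequency by its Fourier transform, a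
  Gaussian of total mass 1 that concentrates at \<open>y\<close>; after rescaling, the convergence is dominated
  convergence and the continuity of \<open>h\<close> at \<open>y\<close>. The cut-off supplies the convergence of the frequency
  integral when the transform is bounded but not integrable.\<close>

lemma regularised_fourier_inversion:
  fixes h :: "real^'n::finite \<Rightarrow> complex"
  assumes cont: "continuous_on UNIV h" and bdd: "bounded (range h)" and int: "integrable lborel h"
  shows "(\<lambda>n. LINT \<omega>|lborel. wave (- (\<omega> \<bullet> y)) * fourier h \<omega>
            * of_real (exp (- pi * (norm \<omega> / Suc n)\<^sup>2))) \<longlonglongrightarrow> h y"
proof -
  obtain M where M: "\<And>x. norm (h x) \<le> M"
    using bdd unfolding bounded_iff by auto
  have meas [measurable]: "h \<in> borel_measurable borel"
    using cont by (rule borel_measurable_continuous_onI)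
  let ?G = "\<lambda>x::real^'n. complex_of_real (exp (- pi * (norm x)\<^sup>2))"
  have "(LINT \<omega>|lborel. wave (- (\<omega> \<bullet> y)) * fourier h \<omega> * of_real (exp (- pi * (norm \<omega> / Suc n)\<^sup>2)))
     = (LINT s|lborel. h (y + (1 / Suc n) *\<^sub>R s) * ?G s)" (is "?L = ?R") for n
  proof -
    define N where "N = real (Suc n)"
    have N: "N > 0" by (simp add: N_def)
    define g where "g \<omega> = complex_of_real (exp (- pi * (norm \<omega> / N)\<^sup>2))" for \<omega> :: "real^'n"
    have [measurable]: "g \<in> borel_measurable borel" unfolding g_def by measurable
    have g_eq: "g = (\<lambda>\<omega>. of_real (exp (- (pi / N\<^sup>2) * (norm \<omega>)\<^sup>2)))"
      by (rule ext) (simp add: g_def power_divide)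
    have g: "integrable lborel g"
      unfolding g_eq using N by (intro integrable_gauss) auto
    define F where "F \<omega> x = wave (x \<bullet> \<omega> - \<omega> \<bullet> y) * (g \<omega> * h x)" for \<omega> x
    have F: "integrable (lborel \<Otimes>\<^sub>M lborel) (\<lambda>(\<omega>, x). F \<omega> x)"
    proof (rule lborel_pair.Fubini_integrable)
      show "(\<lambda>(\<omega>, x). F \<omega> x) \<in> borel_measurable (lborel \<Otimes>\<^sub>M lborel)"
        unfolding F_def by measurable
      have "integrable lborel (\<lambda>\<omega>. norm (g \<omega>) * (LINT x|lborel. norm (h x)))"
        using g by simp
      then show "integrable lborel (\<lambda>\<omega>. LINT x|lborel. norm (case (\<omega>, x) of (\<omega>, x) \<Rightarrow> F \<omega> x))"
        by (simp add: F_def norm_mult)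
      show "AE \<omega> in lborel. integrable lborel (\<lambda>x. case (\<omega>, x) of (\<omega>, x) \<Rightarrow> F \<omega> x)"
      proof (intro AE_I2)
        fix \<omega>
        show "integrable lborel (\<lambda>x. case (\<omega>, x) of (\<omega>, x) \<Rightarrow> F \<omega> x)"
          by (rule Bochner_Integration.integrable_bound[of _ "\<lambda>x. g \<omega> * h x"])
            (auto simp: F_def norm_mult int)
      qed
    qed
    have K: "(LINT \<omega>|lborel. wave (\<omega> \<bullet> v) * g \<omega>) = of_real (N ^ CARD('n)) * ?G (N *\<^sub>R v)" for v
      using N integral_wave_gauss[of "N *\<^sub>R v"]
      by (subst lborel_integral_affine[of N _ 0]) (simp_all add: g_def)
    have "?L = (LINT \<omega>|lborel. LINT x|lborel. F \<omega> x)"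
    proof (rule Bochner_Integration.integral_cong[OF refl])
      fix \<omega>
      have "wave (- (\<omega> \<bullet> y)) * fourier h \<omega> * g \<omega> = (LINT x|lborel. (wave (- (\<omega> \<bullet> y)) * g \<omega>) * (wave (x \<bullet> \<omega>) * h x))"
        by (subst integral_mult_right_zero) (simp add: fourier_def wave_def)
      also have "\<dots> = (LINT x|lborel. F \<omega> x)"
        by (intro Bochner_Integration.integral_cong refl)
          (simp add: F_def wave_add[of "_ \<bullet> _" "- _", simplified] ac_simps)
      finally show "wave (- (\<omega> \<bullet> y)) * fourier h \<omega> * of_real (exp (- pi * (norm \<omega> / Suc n)\<^sup>2)) = (LINT x|lborel. F \<omega> x)"
        by (simp add: g_def N_def)
    qed
    also have "\<dots> = (LINT x|lborel. LINT \<omega>|lborel. F \<omega> x)"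
      using lborel_pair.Fubini_integral[OF F] by simp
    also have "\<dots> = (LINT x|lborel. h x * (of_real (N ^ CARD('n)) * ?G (N *\<^sub>R (x - y))))"
    proof (rule Bochner_Integration.integral_cong[OF refl])
      fix x
      have "(LINT \<omega>|lborel. F \<omega> x) = (LINT \<omega>|lborel. h x * (wave (\<omega> \<bullet> (x - y)) * g \<omega>))"
        by (intro Bochner_Integration.integral_cong refl)
          (simp add: F_def inner_diff_right inner_commute ac_simps)
      then show "(LINT \<omega>|lborel. F \<omega> x) = h x * (of_real (N ^ CARD('n)) * ?G (N *\<^sub>R (x - y)))"
        by (simp only: integral_mult_right_zero K)
    qed
    also have "\<dots> = ?R"
      unfolding N_def[symmetric] using N
      by (subst lborel_integral_affine[of "1 / N" _ y]) (simp_all add: field_simps)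
    finally show ?thesis .
  qed
  moreover have "(\<lambda>n. LINT s|lborel. h (y + (1 / Suc n) *\<^sub>R s) * ?G s) \<longlonglongrightarrow> (LINT s|lborel. h y * ?G s)"
  proof (rule integral_dominated_convergence[where w="\<lambda>s. M * exp (- pi * (norm s)\<^sup>2)"])
    show "integrable lborel (\<lambda>s::real^'n. M * exp (- pi * (norm s)\<^sup>2))"
      using integrable_norm[OF integrable_gauss[of pi]] by (intro integrable_mult_right) simp
    show "AE s in lborel. (\<lambda>n. h (y + (1 / Suc n) *\<^sub>R s) * ?G s) \<longlonglongrightarrow> h y * ?G s"
    proof (intro AE_I2 tendsto_mult tendsto_const)
      fix s
      have "(\<lambda>n. y + (1 / Suc n) *\<^sub>R s) \<longlonglongrightarrow> y + 0 *\<^sub>R s"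
        using LIMSEQ_inverse_real_of_nat by (intro tendsto_intros) (simp add: inverse_eq_divide)
      moreover have "isCont h y" using cont by (simp add: continuous_on_eq_continuous_at)
      ultimately show "(\<lambda>n. h (y + (1 / Suc n) *\<^sub>R s)) \<longlonglongrightarrow> h y"
        by (auto intro: isCont_tendsto_compose)
    qed
  qed (auto simp: norm_mult M mult_right_mono)
  moreover have "(LINT s|lborel. h y * ?G s) = h y"
    using integral_wave_gauss[of "0::real^'n"] by (subst integral_mult_right_zero) simp
  ultimately show ?thesis by (simp only:)
qed

section \<open>Rapid decay and integrability\<close>

text \<open>A product weight: it is integrable because its one-dimensional factors are, and its reciprocal grows
  like \<open>norm x ^ (2 * DIM('a))\<close>, so seminorms with that power control integrals.\<close>

definition decay_weight :: "'a::euclidean_space \<Rightarrow> real" where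
  "decay_weight x = (\<Prod>b\<in>Basis. inverse (1 + (x \<bullet> b)\<^sup>2))"

lemma integrable_decay_weight: "integrable lborel decay_weight"
proof -
  have "integrable lborel (\<lambda>t::real. inverse (1 + t\<^sup>2))"
    using integrable_inverse_1_plus_square by (simp add: set_integrable_def)
  then show ?thesis
    unfolding decay_weight_def by (intro lborel_integrable_prod)
qed

lemma decay_weight_bound:
  fixes x :: "'a::euclidean_space"
  assumes "a \<le> M" and "norm x ^ (2 * DIM('a)) * a \<le> N" and "0 \<le> a"
  shows "a \<le> 2 ^ DIM('a) * (M + N) * decay_weight x"
proof -
  define W where "W = (\<Prod>b\<in>Basis. 1 + (x \<bullet> b)\<^sup>2)"
  have W: "W > 0" "decay_weight x = inverse W"
    unfolding W_def decay_weight_def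
    by (intro prod_pos add_pos_nonneg zero_less_one zero_le_power2)
      (use prod_inversef[of "\<lambda>b. 1 + (x \<bullet> b)\<^sup>2" Basis] in \<open>simp only: o_def\<close>)
  have "W \<le> (\<Prod>b\<in>(Basis::'a set). 1 + (norm x)\<^sup>2)"
    unfolding W_def by (intro prod_mono conjI add_left_mono) (auto simp: abs_le_square_iff[symmetric] Basis_le_norm)
  also have "\<dots> = (1 + (norm x)\<^sup>2) ^ DIM('a)" by simp
  also have "\<dots> \<le> (2 * max 1 ((norm x)\<^sup>2)) ^ DIM('a)"
    by (intro power_mono) auto
  also have "\<dots> \<le> 2 ^ DIM('a) * (1 + norm x ^ (2 * DIM('a)))"
    by (auto simp: power_mult_distrib max_def simp flip: power_mult)
  finally have "W * a \<le> 2 ^ DIM('a) * (1 + norm x ^ (2 * DIM('a))) * a"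
    using assms by (intro mult_right_mono)
  also have "\<dots> = 2 ^ DIM('a) * (a + norm x ^ (2 * DIM('a)) * a)"
    by (simp add: algebra_simps)
  also have "\<dots> \<le> 2 ^ DIM('a) * (M + N)"
    using assms by (intro mult_left_mono add_mono) auto
  finally have "a \<le> 2 ^ DIM('a) * (M + N) / W"
    using W(1) by (simp add: pos_le_divide_eq mult.commute)
  then show ?thesis by (simp only: W(2) divide_inverse)
qed

text \<open>The part of the Schwartz condition that concerns the function itself and not its derivatives.
  Unlike \<^const>\<open>schwartz\<close> it is immediately stable under sums, multiplication by bounded factors and
  restriction to slices, and it is all that the integral defining the distribution below depends on.\<close>

definition rapidly_decaying :: "('a::euclidean_space \<Rightarrow> complex) \<Rightarrow> bool" where
  "rapidly_decaying f \<longleftrightarrow> f \<in> borel_measurable borel \<and> (\<forall>k. \<exists>M. \<forall>x. norm x ^ k * norm (f x) \<le> M)"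

lemma rapidly_decaying_measurable: "rapidly_decaying f \<Longrightarrow> f \<in> borel_measurable borel"
  by (simp add: rapidly_decaying_def)

lemma schwartz_imp_rapidly_decaying:
  assumes "f \<in> schwartz"
  shows "rapidly_decaying f"
proof -
  have "bounded (range (\<lambda>x. norm x ^ k * norm (f x)))" for k
    using assms unfolding schwartz_def by (auto dest!: spec[of _ "[]"])
  then have "\<exists>M. \<forall>x. norm x ^ k * norm (f x) \<le> M" for k
    by (auto simp: bounded_iff abs_mult)
  then show ?thesis
    using assms by (auto simp: rapidly_decaying_def intro!: borel_measurable_continuous_onI schwartz_imp_continuous)
qed

lemma rapidly_decaying_add:
  assumes "rapidly_decaying f" "rapidly_decaying g"
  shows "rapidly_decaying (\<lambda>x. f x + g x)"
  unfolding rapidly_decaying_def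
proof (intro conjI allI)
  show "(\<lambda>x. f x + g x) \<in> borel_measurable borel"
    using assms[THEN rapidly_decaying_measurable] by measurable
  fix k
  obtain M N where "\<And>x. norm x ^ k * norm (f x) \<le> M" "\<And>x. norm x ^ k * norm (g x) \<le> N"
    using assms unfolding rapidly_decaying_def by metis
  then have "norm x ^ k * norm (f x + g x) \<le> M + N" for x
    using mult_left_mono[OF norm_triangle_ineq[of "f x" "g x"], of "norm x ^ k"]
    by (smt (verit) distrib_left norm_ge_zero zero_le_power)
  then show "\<exists>M. \<forall>x. norm x ^ k * norm (f x + g x) \<le> M" by blast
qed

lemma rapidly_decaying_bounded_mult:
  assumes "rapidly_decaying f" and [measurable]: "g \<in> borel_measurable borel" and "\<And>x. norm (g x) \<le> C"
  shows "rapidly_decaying (\<lambda>x. g x * f x)"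
  unfolding rapidly_decaying_def
proof (intro conjI allI)
  show "(\<lambda>x. g x * f x) \<in> borel_measurable borel"
    using assms(1)[THEN rapidly_decaying_measurable] by measurable
  fix k
  obtain M where "\<And>x. norm x ^ k * norm (f x) \<le> M"
    using assms unfolding rapidly_decaying_def by metis
  then have "norm (g x) * (norm x ^ k * norm (f x)) \<le> C * M" for x
    by (intro mult_mono' assms) auto
  then show "\<exists>M. \<forall>x. norm x ^ k * norm (g x * f x) \<le> M"
    by (auto simp: norm_mult mult.left_commute)
qed

lemma rapidly_decaying_le_seminorm:
  assumes "rapidly_decaying f"
  shows "norm x ^ k * norm (f x) \<le> schwartz_seminorm k [] f"
  using assms unfolding schwartz_seminorm_def rapidly_decaying_def
  by (auto intro!: cSUP_upper simp: bdd_above_def)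

lemma rapidly_decaying_bounded_range: "rapidly_decaying f \<Longrightarrow> bounded (range f)"
  using rapidly_decaying_le_seminorm[of f _ 0] by (auto simp: bounded_iff)

lemma
  fixes f :: "'a::euclidean_space \<Rightarrow> complex"
  assumes f: "rapidly_decaying f"
  shows rapidly_decaying_integrable: "integrable lborel f"
    and rapidly_decaying_integral_bound: "norm (LINT x|lborel. f x) \<le> 2 ^ DIM('a) *
      (schwartz_seminorm 0 [] f + schwartz_seminorm (2 * DIM('a)) [] f) * (LINT x|lborel. decay_weight (x::'a))"
proof -
  let ?C = "2 ^ DIM('a) * (schwartz_seminorm 0 [] f + schwartz_seminorm (2 * DIM('a)) [] f)"
  have b: "norm (f x) \<le> ?C * decay_weight x" for x
    using rapidly_decaying_le_seminorm[OF f, of x 0] rapidly_decaying_le_seminorm[OF f, of x "2 * DIM('a)"]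
    by (intro decay_weight_bound norm_ge_zero) auto
  have int: "integrable lborel (\<lambda>x::'a. ?C * decay_weight x)"
    by (intro integrable_mult_right integrable_decay_weight)
  show intf: "integrable lborel f"
    by (rule Bochner_Integration.integrable_bound[OF int])
      (use b rapidly_decaying_measurable[OF f] in \<open>auto intro: order_trans[OF _ abs_ge_self]\<close>)
  have "norm (LINT x|lborel. f x) \<le> (LINT x|lborel. norm (f x))"
    by (rule integral_norm_bound)
  also have "\<dots> \<le> (LINT x|lborel. ?C * decay_weight (x::'a))"
    by (intro integral_mono int b integrable_norm intf)
  finally show "norm (LINT x|lborel. f x) \<le> ?C * (LINT x|lborel. decay_weight (x::'a))"
    by simp
qed

lemma schwartz_bounded_range: "f \<in> schwartz \<Longrightarrow> bounded (range f)"
  by (intro rapidly_decaying_bounded_range schwartz_imp_rapidly_decaying)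

lemma schwartz_integrable: "f \<in> schwartz \<Longrightarrow> integrable lborel f"
  by (intro rapidly_decaying_integrable schwartz_imp_rapidly_decaying)

lemma fourier_injective:
  assumes "f \<in> schwartz" and "\<And>\<omega>. fourier f \<omega> = 0"
  shows "f x = 0"
proof -
  have "(\<lambda>n::nat. 0) \<longlonglongrightarrow> f x"
    using regularised_fourier_inversion[OF schwartz_imp_continuous schwartz_bounded_range schwartz_integrable,
        OF assms(1) assms(1) assms(1), of x]
    by (simp add: assms(2))
  then show ?thesis using LIMSEQ_const_iff by metis
qed

section \<open>Cohen kernels given by chirps\<close>

text \<open>The pairing with the chirp \<open>exp (- 2 \<pi> i c x \<bullet> \<omega>)\<close>, normalised by \<open>\<bar>c\<bar> ^ d\<close>, where the inner integral over
  \<open>\<omega>\<close> is summed with a Gaussian cut-off. On rapidly decaying functions the cut-off disappears in the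
  limit and an absolutely convergent double integral remains. On Wigner distributions, whose \<open>\<omega>\<close>-slices
  are Fourier transforms, the regularised inner integral is evaluated by Fourier inversion.\<close>

definition chirp_distribution :: "real \<Rightarrow> ('n::finite) phase_fun \<Rightarrow> complex" where
  "chirp_distribution c \<Phi> = (LINT x|lborel. of_real (\<bar>c\<bar> ^ CARD('n)) *
     lim (\<lambda>n. LINT \<omega>|lborel. wave (c * (x \<bullet> \<omega>)) * \<Phi> (x, \<omega>) *
       of_real (exp (- pi * (norm \<omega> / Suc n)\<^sup>2))))"

lemma chirp_measurable:
  "(\<lambda>z. wave (c * (fst z \<bullet> snd z))) \<in> borel_measurable borel"
  by (intro borel_measurable_continuous_onI continuous_intros)

lemma rapidly_decaying_section:
  assumes "rapidly_decaying \<Phi>"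
  shows "rapidly_decaying (\<lambda>\<omega>. \<Phi> (x, \<omega>))"
  unfolding rapidly_decaying_def
proof (intro conjI allI)
  show "(\<lambda>\<omega>. \<Phi> (x, \<omega>)) \<in> borel_measurable borel"
    using rapidly_decaying_measurable[OF assms] by measurable
  fix k
  obtain M where M: "\<And>z. norm z ^ k * norm (\<Phi> z) \<le> M"
    using assms unfolding rapidly_decaying_def by metis
  have "norm \<omega> ^ k * norm (\<Phi> (x, \<omega>)) \<le> M" for \<omega>
  proof -
    have "norm \<omega> ^ k \<le> norm (x, \<omega>) ^ k"
      using norm_snd_le[of \<omega> x] by (intro power_mono) auto
    from mult_right_mono[OF this norm_ge_zero[of "\<Phi> (x, \<omega>)"]] M[of "(x, \<omega>)"]
    show ?thesis by linarith
  qed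
  then show "\<exists>M. \<forall>\<omega>. norm \<omega> ^ k * norm (\<Phi> (x, \<omega>)) \<le> M" by blast
qed

lemma chirp_distribution_decaying:
  fixes \<Phi> :: "'n::finite phase_fun"
  assumes \<Phi>: "rapidly_decaying \<Phi>"
  shows "chirp_distribution c \<Phi> =
    of_real (\<bar>c\<bar> ^ CARD('n)) * (LINT z|lborel. wave (c * (fst z \<bullet> snd z)) * \<Phi> z)"
proof -
  have int: "integrable lborel (\<lambda>z. wave (c * (fst z \<bullet> snd z)) * \<Phi> z)"
    by (intro rapidly_decaying_integrable rapidly_decaying_bounded_mult[OF \<Phi>, of _ 1] chirp_measurable) auto
  have lim: "lim (\<lambda>n. LINT \<omega>|lborel. wave (c * (x \<bullet> \<omega>)) * \<Phi> (x, \<omega>) * of_real (exp (- pi * (norm \<omega> / Suc n)\<^sup>2)))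
     = (LINT \<omega>|lborel. wave (c * (x \<bullet> \<omega>)) * \<Phi> (x, \<omega>))" for x
  proof (rule limI, rule integral_dominated_convergence[where w="\<lambda>\<omega>. norm (\<Phi> (x, \<omega>))"])
    show "integrable lborel (\<lambda>\<omega>. norm (\<Phi> (x, \<omega>)))"
      by (intro integrable_norm rapidly_decaying_integrable rapidly_decaying_section \<Phi>)
    have [measurable]: "\<Phi> \<in> borel_measurable borel" by (rule rapidly_decaying_measurable[OF \<Phi>])
    show "(\<lambda>\<omega>. wave (c * (x \<bullet> \<omega>)) * \<Phi> (x, \<omega>)) \<in> borel_measurable lborel"
      by measurable
    show "(\<lambda>\<omega>. wave (c * (x \<bullet> \<omega>)) * \<Phi> (x, \<omega>) * of_real (exp (- pi * (norm \<omega> / Suc n)\<^sup>2))) \<in> borel_measurable lborel" for n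
      by measurable
    show "AE \<omega> in lborel. (\<lambda>n. wave (c * (x \<bullet> \<omega>)) * \<Phi> (x, \<omega>) * of_real (exp (- pi * (norm \<omega> / Suc n)\<^sup>2)))
        \<longlonglongrightarrow> wave (c * (x \<bullet> \<omega>)) * \<Phi> (x, \<omega>)"
    proof (intro AE_I2)
      fix \<omega> :: "real^'n"
      have "(\<lambda>n. inverse (real (Suc n))) \<longlonglongrightarrow> 0"
        by (rule LIMSEQ_inverse_real_of_nat)
      then have "(\<lambda>n. norm \<omega> / Suc n) \<longlonglongrightarrow> norm \<omega> * 0"
        unfolding divide_inverse by (intro tendsto_mult tendsto_const)
      then have "(\<lambda>n. exp (- pi * (norm \<omega> / Suc n)\<^sup>2)) \<longlonglongrightarrow> exp (- pi * (norm \<omega> * 0)\<^sup>2)"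
        by (intro tendsto_intros)
      then have "(\<lambda>n. wave (c * (x \<bullet> \<omega>)) * \<Phi> (x, \<omega>) * of_real (exp (- pi * (norm \<omega> / Suc n)\<^sup>2)))
        \<longlonglongrightarrow> wave (c * (x \<bullet> \<omega>)) * \<Phi> (x, \<omega>) * of_real (exp (- pi * (norm \<omega> * 0)\<^sup>2))"
        by (intro tendsto_mult tendsto_const tendsto_of_real)
      then show "(\<lambda>n. wave (c * (x \<bullet> \<omega>)) * \<Phi> (x, \<omega>) * of_real (exp (- pi * (norm \<omega> / Suc n)\<^sup>2)))
        \<longlonglongrightarrow> wave (c * (x \<bullet> \<omega>)) * \<Phi> (x, \<omega>)" by simp
    qed
  qed (auto simp: norm_mult intro!: mult_left_le)
  have "chirp_distribution c \<Phi> =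
      of_real (\<bar>c\<bar> ^ CARD('n)) * (LINT x|lborel. LINT \<omega>|lborel. wave (c * (x \<bullet> \<omega>)) * \<Phi> (x, \<omega>))"
    unfolding chirp_distribution_def lim by (rule integral_mult_right_zero)
  also have "(LINT x|lborel. LINT \<omega>|lborel. wave (c * (x \<bullet> \<omega>)) * \<Phi> (x, \<omega>))
    = (LINT z|lborel. wave (c * (fst z \<bullet> snd z)) * \<Phi> z)"
    using lborel_pair.integral_fst'[of "\<lambda>z. wave (c * (fst z \<bullet> snd z)) * \<Phi> z"] int
    by (simp add: lborel_prod)
  finally show ?thesis .
qed

text \<open>Continuity holds because the double integral is bounded by two seminorms of order 0 in the
  derivatives, through the integrable decay weight on phase space.\<close>

lemma tempered_chirp_distribution: "tempered_distribution (chirp_distribution c :: ('n::finite phase_fun \<Rightarrow> complex))"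
proof -
  let ?w = "\<lambda>z::(real^'n) \<times> (real^'n). wave (c * (fst z \<bullet> snd z))"
  have dec: "rapidly_decaying (\<lambda>z. ?w z * \<Phi> z)" if "rapidly_decaying \<Phi>" for \<Phi>
    by (rule rapidly_decaying_bounded_mult[of _ _ 1, OF that chirp_measurable]) auto
  note int = rapidly_decaying_integrable[OF dec]
  have add: "chirp_distribution c (\<lambda>z. \<Phi> z + \<Psi> z) = chirp_distribution c \<Phi> + chirp_distribution c \<Psi>"
    if "rapidly_decaying \<Phi>" "rapidly_decaying \<Psi>" for \<Phi> \<Psi> :: "'n phase_fun"
    unfolding chirp_distribution_decaying[OF that(1)] chirp_distribution_decaying[OF that(2)]
      chirp_distribution_decaying[OF rapidly_decaying_add[OF that]] distrib_left
    by (subst Bochner_Integration.integral_add) (simp_all add: int that distrib_left)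
  have scale: "chirp_distribution c (\<lambda>z. a * \<Phi> z) = a * chirp_distribution c \<Phi>"
    "rapidly_decaying (\<lambda>z. a * \<Phi> z)"
    if "rapidly_decaying \<Phi>" for a and \<Phi> :: "'n phase_fun"
  proof -
    show a: "rapidly_decaying (\<lambda>z. a * \<Phi> z)"
      using that by (rule rapidly_decaying_bounded_mult[of _ _ "norm a"]) auto
    show "chirp_distribution c (\<lambda>z. a * \<Phi> z) = a * chirp_distribution c \<Phi>"
    proof -
      have "(LINT z|lborel. ?w z * (a * \<Phi> z)) = (LINT z|lborel. a * (?w z * \<Phi> z))"
        by (intro Bochner_Integration.integral_cong refl mult.left_commute)
      then show ?thesis
        unfolding chirp_distribution_decaying[OF that] chirp_distribution_decaying[OF a]
        by (simp only: integral_mult_right_zero) (rule mult.left_commute)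
    qed
  qed
  show ?thesis
    unfolding tempered_distribution_def
  proof (intro conjI ballI allI impI)
  fix \<phi> \<psi> :: "'n phase_fun" and a
  assume \<phi>: "\<phi> \<in> schwartz"
  show "chirp_distribution c (\<lambda>z. a * \<phi> z) = a * chirp_distribution c \<phi>"
    by (intro scale schwartz_imp_rapidly_decaying \<phi>)
  assume "\<psi> \<in> schwartz"
  with \<phi> show "chirp_distribution c (\<lambda>z. \<phi> z + \<psi> z) = chirp_distribution c \<phi> + chirp_distribution c \<psi>"
    by (intro add schwartz_imp_rapidly_decaying)
next
  let ?D = "DIM((real^'n) \<times> (real^'n))"
  fix \<phi> :: "nat \<Rightarrow> 'n phase_fun" and \<psi>
  assume \<phi>: "\<forall>n. \<phi> n \<in> schwartz" and \<psi>: "\<psi> \<in> schwartz" and conv: "schwartz_converges \<phi> \<psi>"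
  define \<delta> where "\<delta> n = (\<lambda>z. \<phi> n z - \<psi> z)" for n
  have \<delta>_dec: "rapidly_decaying (\<delta> n)" for n
    using rapidly_decaying_add[OF _ scale(2), of "\<phi> n" \<psi> "-1"] \<phi> \<psi>
    by (simp add: \<delta>_def schwartz_imp_rapidly_decaying)
  define K where "K = \<bar>c\<bar> ^ CARD('n) * 2 ^ ?D * (LINT z|lborel. decay_weight (z::(real^'n) \<times> (real^'n)))"
  define S where "S n = schwartz_seminorm 0 [] (\<delta> n) + schwartz_seminorm (2 * ?D) [] (\<delta> n)" for n
  have "norm (chirp_distribution c (\<phi> n) - chirp_distribution c \<psi>) \<le> K * S n" for n
  proof -
    have "chirp_distribution c (\<phi> n) = chirp_distribution c (\<lambda>z. \<delta> n z + \<psi> z)"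
      by (simp add: \<delta>_def)
    also have "\<dots> = chirp_distribution c (\<delta> n) + chirp_distribution c \<psi>"
      by (intro add \<delta>_dec schwartz_imp_rapidly_decaying \<psi>)
    finally have "norm (chirp_distribution c (\<phi> n) - chirp_distribution c \<psi>) = norm (chirp_distribution c (\<delta> n))"
      by simp
    also have "\<dots> = \<bar>c\<bar> ^ CARD('n) * norm (LINT z|lborel. ?w z * \<delta> n z)"
      unfolding chirp_distribution_decaying[OF \<delta>_dec] norm_mult norm_of_real by simp
    also have "\<dots> \<le> \<bar>c\<bar> ^ CARD('n) * (2 ^ ?D *
       (schwartz_seminorm 0 [] (\<lambda>z. ?w z * \<delta> n z) + schwartz_seminorm (2 * ?D) [] (\<lambda>z. ?w z * \<delta> n z)) *
       (LINT z|lborel. decay_weight (z::(real^'n) \<times> (real^'n))))"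
      by (intro mult_left_mono rapidly_decaying_integral_bound dec \<delta>_dec) auto
    also have "\<dots> = K * S n"
      by (simp only: K_def S_def schwartz_seminorm_def iter_deriv.simps norm_mult norm_wave mult_1 ac_simps)
    finally show ?thesis .
  qed
  moreover have "(\<lambda>n. K * S n) \<longlonglongrightarrow> K * (0 + 0)"
    unfolding S_def \<delta>_def
    by (intro tendsto_mult tendsto_add tendsto_const conv[unfolded schwartz_converges_def, rule_format]) simp_all
  then have "(\<lambda>n. K * S n) \<longlonglongrightarrow> 0" by simp
  ultimately have "(\<lambda>n. chirp_distribution c (\<phi> n) - chirp_distribution c \<psi>) \<longlonglongrightarrow> 0"
    by (rule Lim_null_comparison[OF always_eventually[OF allI]])
  then show "(\<lambda>n. chirp_distribution c (\<phi> n)) \<longlonglongrightarrow> chirp_distribution c \<psi>"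
    by (simp add: LIM_zero_iff)
  qed
qed

lemma schwartz_affine_product:
  fixes f g :: "'n::finite signal"
  assumes f: "f \<in> schwartz" and g: "g \<in> schwartz" and a: "a \<noteq> 0"
  shows "continuous_on UNIV (\<lambda>y. f (u + a *\<^sub>R y) * cnj (g (v + b *\<^sub>R y)))" (is ?cont)
    and "bounded (range (\<lambda>y. f (u + a *\<^sub>R y) * cnj (g (v + b *\<^sub>R y))))" (is ?bdd)
    and "integrable lborel (\<lambda>y. f (u + a *\<^sub>R y) * cnj (g (v + b *\<^sub>R y)))" (is ?int)
proof -
  obtain M N where M: "\<And>x. norm (f x) \<le> M" and N: "\<And>x. norm (g x) \<le> N"
    using schwartz_bounded_range[OF f] schwartz_bounded_range[OF g] by (auto simp: bounded_iff)
  show ?cont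
    by (intro continuous_intros continuous_on_compose2[OF schwartz_imp_continuous[OF f]]
        continuous_on_compose2[OF schwartz_imp_continuous[OF g]]) auto
  then have meas: "(\<lambda>y. f (u + a *\<^sub>R y) * cnj (g (v + b *\<^sub>R y))) \<in> borel_measurable borel"
    by (rule borel_measurable_continuous_onI)
  have "norm (f x * cnj (g y)) \<le> M * N" for x y
    unfolding norm_mult complex_mod_cnj by (intro mult_mono' M N) auto
  then show ?bdd unfolding bounded_iff by blast
  have "integrable lborel (\<lambda>y. N *\<^sub>R f (u + a *\<^sub>R y))"
    by (intro integrable_scaleR_right lborel_integrable_affine a schwartz_integrable f)
  then show ?int
  proof (rule Bochner_Integration.integrable_bound)
    have "norm (f (u + a *\<^sub>R y) * cnj (g (v + b *\<^sub>R y))) \<le> norm (N *\<^sub>R f (u + a *\<^sub>R y))" for y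
      using mult_right_mono[OF order_trans[OF N[of "v + b *\<^sub>R y"] abs_ge_self], of "norm (f (u + a *\<^sub>R y))"]
      by (simp add: norm_mult mult.commute)
    then show "AE y in lborel. norm (f (u + a *\<^sub>R y) * cnj (g (v + b *\<^sub>R y))) \<le> norm (N *\<^sub>R f (u + a *\<^sub>R y))"
      by (intro AE_I2)
  qed (use meas in simp)
qed

text \<open>For a fixed outer variable \<open>t\<close>, the slice \<open>\<eta> \<mapsto> wigner f g (x - t, \<omega> - \<eta>)\<close> is the Fourier transform at
  \<open>- \<eta>\<close> of the modulated product \<open>h\<close>, so the inner integral inverts it at the point \<open>c t\<close>. The chirp thereby ties the
  lag variable of the Wigner distribution to the smoothing variable \<open>t\<close>; the substitution \<open>y = c t\<close>, whose Jacobian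
  is the normalising factor, gives the stated integral.\<close>

lemma chirp_distribution_wigner:
  fixes f g :: "'n::finite signal"
  assumes f: "f \<in> schwartz" and g: "g \<in> schwartz" and c: "c \<noteq> 0"
  shows "conv_distribution (wigner f g) (chirp_distribution c) (x, \<omega>) =
    (LINT y|lborel. wave (\<omega> \<bullet> y) * f (x + (1/2 - 1/c) *\<^sub>R y) * cnj (g (x - (1/2 + 1/c) *\<^sub>R y)))"
proof -
  have inner: "lim (\<lambda>n. LINT \<eta>|lborel. wave (c * (t \<bullet> \<eta>)) * wigner f g ((x, \<omega>) - (t, \<eta>)) *
       of_real (exp (- pi * (norm \<eta> / Suc n)\<^sup>2)))
     = wave (c * (t \<bullet> \<omega>)) * (f (x - t + (c/2) *\<^sub>R t) * cnj (g (x - t - (c/2) *\<^sub>R t)))" for t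
  proof (rule limI)
    \<comment> \<open>The modulation by \<open>\<omega>\<close> keeps the Gaussian cut-off centred at 0 after the reflection of \<open>\<eta>\<close>.\<close>
    define h where "h y = wave (y \<bullet> \<omega>) * (f (x - t + (1/2) *\<^sub>R y) * cnj (g (x - t + (- (1/2)) *\<^sub>R y)))" for y
    have half: "(1/2::real) \<noteq> 0" by simp
    note prod = schwartz_affine_product[OF f g half, of "x - t" "x - t" "- (1/2)"]
    have cont: "continuous_on UNIV h"
      unfolding h_def by (rule continuous_on_mult[OF _ prod(1)]) (intro continuous_intros)
    have bdd: "bounded (range h)"
      using prod(2) by (simp add: h_def bounded_iff norm_mult)
    have int: "integrable lborel h"
      by (rule Bochner_Integration.integrable_bound[OF prod(3)])
        (use borel_measurable_continuous_onI[OF cont] in \<open>auto simp: h_def norm_mult\<close>)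
    have W: "wigner f g ((x, \<omega>) - (t, \<eta>)) = fourier h (- \<eta>)" for \<eta>
      unfolding wigner_def fourier_def h_def diff_Pair prod.case wave_def[symmetric]
      by (intro Bochner_Integration.integral_cong refl)
        (simp add: inner_diff_right wave_add[of "_ \<bullet> _" "- _", simplified] ac_simps)
    have "(LINT \<eta>|lborel. wave (c * (t \<bullet> \<eta>)) * wigner f g ((x, \<omega>) - (t, \<eta>)) * of_real (exp (- pi * (norm \<eta> / Suc n)\<^sup>2)))
      = (LINT \<eta>|lborel. wave (- (\<eta> \<bullet> (c *\<^sub>R t))) * fourier h \<eta> * of_real (exp (- pi * (norm \<eta> / Suc n)\<^sup>2)))" for n
      unfolding W by (subst lborel_integral_affine[of "-1" _ 0]) (simp_all add: inner_commute)
    then show "(\<lambda>n. LINT \<eta>|lborel. wave (c * (t \<bullet> \<eta>)) * wigner f g ((x, \<omega>) - (t, \<eta>)) *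
       of_real (exp (- pi * (norm \<eta> / Suc n)\<^sup>2)))
     \<longlonglongrightarrow> wave (c * (t \<bullet> \<omega>)) * (f (x - t + (c/2) *\<^sub>R t) * cnj (g (x - t - (c/2) *\<^sub>R t)))"
      using regularised_fourier_inversion[OF cont bdd int, of "c *\<^sub>R t"] by (simp add: h_def)
  qed
  define F where "F y = wave (\<omega> \<bullet> y) * f (x + (1/2 - 1/c) *\<^sub>R y) * cnj (g (x - (1/2 + 1/c) *\<^sub>R y))" for y
  have F: "wave (c * (t \<bullet> \<omega>)) * (f (x - t + (c/2) *\<^sub>R t) * cnj (g (x - t - (c/2) *\<^sub>R t)))
     = F (0 + c *\<^sub>R t)" for t
    using c by (simp add: F_def algebra_simps inner_commute)
  have "conv_distribution (wigner f g) (chirp_distribution c) (x, \<omega>)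
      = (LINT t|lborel. of_real (\<bar>c\<bar> ^ CARD('n)) * F (0 + c *\<^sub>R t))"
    unfolding conv_distribution_def chirp_distribution_def inner F ..
  also have "\<dots> = (LINT y|lborel. F y)"
    using lborel_integral_affine[OF c, of F 0] by simp
  finally show ?thesis unfolding F_def .
qed

section \<open>Covariance determines the blocks up to one matrix\<close>

lemma continuous_nonneg_integral_eq_0:
  fixes F :: "'a::euclidean_space \<Rightarrow> real"
  assumes cont: "continuous_on UNIV F" and nonneg: "\<And>x. 0 \<le> F x"
    and int: "integrable lborel F" and zero: "(LINT x|lborel. F x) = 0"
  shows "F x = 0"
proof -
  have "AE x in lborel. F x = 0"
    using integral_nonneg_eq_0_iff_AE[OF int] nonneg zero by simp
  then have "AE x in lebesgue. x \<in> {x. F x = 0}"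
    by (simp add: AE_completion)
  moreover have "closed {x. F x = 0}"
    by (rule closed_Collect_eq[OF cont continuous_on_const])
  ultimately show ?thesis
    using mem_closed_if_AE_lebesgue by blast
qed

lemma matrix_dist_wave:
  "matrix_dist A f g (x, \<omega>) = (LINT y|lborel. wave (\<omega> \<bullet> y) *
     f (block11 A *v x + block12 A *v y) * cnj (g (block21 A *v x + block22 A *v y)))"
  by (simp add: matrix_dist_def wave_def)

text \<open>Convolution commutes with translations of phase space. Hence every symmetry of signals that
  acts on the Wigner distribution as a translation acts in the same way on each member of the
  Cohen class; \<open>wigner_translate\<close> and \<open>wigner_modulate\<close> supply the two families of such symmetries.\<close>

lemma cohen_class_covariant:
  assumes "cohen_class B"
    and "f \<in> schwartz" "g \<in> schwartz" "f' \<in> schwartz" "g' \<in> schwartz"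
    and W: "\<And>z. wigner f' g' z = wigner f g (z - v)"
  shows "B f' g' z = B f g (z - v)"
proof -
  obtain \<theta> where \<theta>: "\<And>f g. f \<in> schwartz \<Longrightarrow> g \<in> schwartz \<Longrightarrow> B f g = conv_distribution (wigner f g) \<theta>"
    using assms(1) unfolding cohen_class_def by blast
  show ?thesis
    by (simp add: \<theta> assms(2-5) conv_distribution_def W algebra_simps)
qed

lemma wigner_translate:
  "wigner (\<lambda>t. f (t - u)) (\<lambda>t. g (t - u)) z = wigner f g (z - (u, 0))"
  by (cases z) (simp add: wigner_def algebra_simps)

lemma wigner_modulate:
  "wigner (\<lambda>t. wave (- (t \<bullet> \<zeta>)) * f t) (\<lambda>t. wave (- (t \<bullet> \<zeta>)) * g t) z = wigner f g (z - (0, \<zeta>))"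
proof (cases z)
  case (Pair x \<omega>)
  have eq: "wave (y \<bullet> \<omega>) * (wave (- ((x + (1/2) *\<^sub>R y) \<bullet> \<zeta>)) * f (x + (1/2) *\<^sub>R y)) * cnj (wave (- ((x - (1/2) *\<^sub>R y) \<bullet> \<zeta>)) * g (x - (1/2) *\<^sub>R y))
    = wave (y \<bullet> (\<omega> - \<zeta>)) * f (x + (1/2) *\<^sub>R y) * cnj (g (x - (1/2) *\<^sub>R y))" for y
  proof -
    have "wave (y \<bullet> \<omega>) * wave (- ((x + (1/2) *\<^sub>R y) \<bullet> \<zeta>)) * wave ((x - (1/2) *\<^sub>R y) \<bullet> \<zeta>) = wave (y \<bullet> (\<omega> - \<zeta>))"
      unfolding wave_add[symmetric] by (simp add: inner_simps)
    then show ?thesis by (simp add: cnj_wave ac_simps)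
  qed
  then show ?thesis
    unfolding Pair wigner_def wave_def[symmetric] diff_Pair prod.case diff_zero by (simp only: eq)
qed

lemma sum_UNIV_sum:
  fixes h :: "'a::finite + 'b::finite \<Rightarrow> 'c::comm_monoid_add"
  shows "(\<Sum>k\<in>UNIV. h k) = (\<Sum>i\<in>UNIV. h (Inl i)) + (\<Sum>j\<in>UNIV. h (Inr j))"
  unfolding UNIV_Plus_UNIV[symmetric] by (subst sum.Plus) auto

lemma block_column_injective:
  fixes A :: "real^('n::finite + 'n)^('n + 'n)"
  assumes A: "invertible A" and "block12 A *v y = 0" "block22 A *v y = 0"
  shows "y = 0"
proof -
  define v :: "real^('n + 'n)" where "v = (\<chi> k. case k of Inl i \<Rightarrow> 0 | Inr i \<Rightarrow> y $ i)"
  have "(A *v v) $ k = 0" for k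
  proof (cases k)
    case (Inl i)
    have "(A *v v) $ k = (block12 A *v y) $ i"
      unfolding matrix_vector_mult_def sum_UNIV_sum Inl by (simp add: v_def block12_def sum_UNIV_sum)
    then show ?thesis by (simp add: assms)
  next
    case (Inr i)
    have "(A *v v) $ k = (block22 A *v y) $ i"
      unfolding matrix_vector_mult_def sum_UNIV_sum Inr by (simp add: v_def block22_def sum_UNIV_sum)
    then show ?thesis by (simp add: assms)
  qed
  then have "A *v v = 0" by (simp add: vec_eq_iff)
  moreover obtain A' where "A' ** A = mat 1" using A invertible_def by blast
  ultimately have "v = 0"
    by (metis matrix_vector_mul_assoc matrix_vector_mul_lid matrix_vector_mult_0_right)
  then have "v $ Inr i = 0" for i by simp
  then show ?thesis by (simp add: v_def vec_eq_iff)
qed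

text \<open>The product of the two unnormalised Gaussians in the integrand of a matrix distribution at time 0.\<close>

definition pair_gauss :: "real^'n^'n \<Rightarrow> real^'n^'n \<Rightarrow> real^'n::finite \<Rightarrow> real" where
  "pair_gauss R S y = exp (- ((norm (R *v y))\<^sup>2 + (norm (S *v y))\<^sup>2))"

lemma pair_gauss_pos: "pair_gauss R S y > 0"
  by (simp add: pair_gauss_def)

lemma continuous_on_matrix_vector [continuous_intros]:
  fixes R :: "real^'n::finite^'m::finite"
  shows "continuous_on T f \<Longrightarrow> continuous_on T (\<lambda>y. R *v f y)"
  by (rule bounded_linear.continuous_on[OF matrix_vector_mul_bounded_linear])

lemma continuous_on_pair_gauss: "continuous_on UNIV (pair_gauss R S)"
  unfolding pair_gauss_def by (intro continuous_intros)

text \<open>The joint kernel of \<open>R\<close> and \<open>S\<close> is trivial, so \<open>y \<mapsto> (R y, S y)\<close> is bounded below and the product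
  decays like a Gaussian. The exponent \<open>k\<close> leaves room for absorbing polynomial factors.\<close>

lemma integrable_pair_gauss:
  fixes R S :: "real^'n::finite^'n"
  assumes inj: "\<And>y. R *v y = 0 \<Longrightarrow> S *v y = 0 \<Longrightarrow> y = 0" and k: "k > 0"
  shows "integrable lborel (\<lambda>y. pair_gauss R S y powr k)"
proof -
  define L where "L y = (R *v y, S *v y)" for y
  have "linear L" unfolding L_def
    by (auto intro!: linearI simp: matrix_vector_right_distrib matrix_vector_mult_scaleR)
  moreover from this have "inj L"
    by (simp add: linear_injective_0 L_def inj prod_eq_iff zero_prod_def)
  ultimately obtain B where B: "B > 0" "\<And>y. B * norm y \<le> norm (L y)"
    using linear_inj_bounded_below_pos[of L] by metis
  have le: "pair_gauss R S y powr k \<le> exp (- (k * B\<^sup>2) * (norm y)\<^sup>2)" for y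
  proof -
    have "(B * norm y)\<^sup>2 \<le> (norm (L y))\<^sup>2"
      using B by (intro power_mono) auto
    also have "\<dots> = (norm (R *v y))\<^sup>2 + (norm (S *v y))\<^sup>2"
      by (simp add: L_def norm_Pair)
    finally have "k * (B * norm y)\<^sup>2 \<le> k * ((norm (R *v y))\<^sup>2 + (norm (S *v y))\<^sup>2)"
      using k by (intro mult_left_mono) auto
    moreover have "pair_gauss R S y powr k = exp (- (k * ((norm (R *v y))\<^sup>2 + (norm (S *v y))\<^sup>2)))"
      by (simp add: pair_gauss_def exp_powr_real algebra_simps)
    ultimately show ?thesis
      by (simp add: power_mult_distrib mult.assoc)
  qed
  have "integrable lborel (\<lambda>y::real^'n. norm (complex_of_real (exp (- (k * B\<^sup>2) * (norm y)\<^sup>2))))"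
    using B(1) k by (intro integrable_norm integrable_gauss) simp
  then show ?thesis
  proof (rule Bochner_Integration.integrable_bound)
    show "(\<lambda>y. pair_gauss R S y powr k) \<in> borel_measurable lborel"
      using borel_measurable_continuous_onI[OF continuous_on_pair_gauss[of R S]] by measurable
    show "AE y in lborel. norm (pair_gauss R S y powr k) \<le> norm (norm (complex_of_real (exp (- (k * B\<^sup>2) * (norm y)\<^sup>2))))"
      using le by (intro AE_I2) simp
  qed
qed

lemma integrable_pair_gauss_base:
  fixes R S :: "real^'n::finite^'n"
  assumes inj: "\<And>y. R *v y = 0 \<Longrightarrow> S *v y = 0 \<Longrightarrow> y = 0"
  shows "integrable lborel (pair_gauss R S)"
proof -
  have "integrable lborel (\<lambda>y. pair_gauss R S y powr 1)"
    by (rule integrable_pair_gauss[OF inj zero_less_one])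
  then show ?thesis using pair_gauss_pos[of R S, THEN less_imp_le] by simp
qed

lemma wave_packet_product:
  "wave_packet a c s * cnj (wave_packet b d t)
   = wave (t \<bullet> b - s \<bullet> a) * of_real (exp (- ((norm (s - c))\<^sup>2 + (norm (t - d))\<^sup>2)))"
proof -
  have "exp (- ((norm (s - c))\<^sup>2 + (norm (t - d))\<^sup>2)) = exp (- (norm (s - c))\<^sup>2) * exp (- (norm (t - d))\<^sup>2)"
    by (simp flip: exp_add)
  then show ?thesis
    using wave_add[of "t \<bullet> b" "- (s \<bullet> a)"]
    by (simp add: wave_packet_def cnj_wave ac_simps)
qed

lemma wave_trivial_imp_0:
  assumes "\<And>\<eta>. wave (p \<bullet> \<eta>) = 1"
  shows "p = (0::'a::real_inner)"
proof (rule ccontr)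
  assume "p \<noteq> 0"
  then have "p \<bullet> ((1 / (2 * (p \<bullet> p))) *\<^sub>R p) = 1/2" by simp
  with assms wave_half show False by (metis one_neq_neg_one)
qed

text \<open>Time shifts act on the Wigner distribution by \<open>x \<mapsto> x - u\<close>, and the defects \<open>p\<close>, \<open>q\<close> measure the failure of
  the first block column to respect this. Test signals are Gaussians with independent frequencies
  \<open>\<eta>\<close>, \<open>\<eta>'\<close>. Choosing \<open>\<omega>\<close> to cancel all oscillation in the integrals, covariance becomes
  \<open>K = wave (q \<bullet> \<eta>' - p \<bullet> \<eta>) * K'\<close> with \<open>K > 0\<close> and both integrals independent of the frequencies, so the
  character is trivial and the defects vanish.\<close>

lemma cohen_class_time_blocks:
  assumes A: "invertible A" and B: "cohen_class (matrix_dist A)"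
  shows "block11 A *v u = u" and "block21 A *v u = u"
proof -
  let ?R = "block12 A" and ?S = "block22 A"
  define p q where "p = u - block11 A *v u" and "q = u - block21 A *v u"
  define K where "K = (LINT y|lborel. complex_of_real (pair_gauss ?R ?S y))"
  define K' where "K' = (LINT y|lborel. complex_of_real (exp (- ((norm (?R *v y + p))\<^sup>2 + (norm (?S *v y + q))\<^sup>2))))"
  have key: "K = wave (q \<bullet> \<eta>' - p \<bullet> \<eta>) * K'" for \<eta> \<eta>'
  proof -
    \<comment> \<open>This frequency cancels the modulations of both wave packets.\<close>
    define \<omega> where "\<omega> = \<eta> v* ?R - \<eta>' v* ?S"
    have \<omega>: "\<omega> \<bullet> y = (?R *v y) \<bullet> \<eta> - (?S *v y) \<bullet> \<eta>'" for y
      unfolding \<omega>_def inner_diff_left dot_lmul_matrix by (simp add: inner_commute)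
    let ?f = "wave_packet \<eta> 0" and ?g = "wave_packet \<eta>' 0"
    have neg: "block11 A *v (- u) + ?R *v y + u = ?R *v y + p" "block21 A *v (- u) + ?S *v y + u = ?S *v y + q" for y
      using matrix_vector_mult_diff_distrib[of _ 0 u] by (simp_all add: p_def q_def)
    have "K = (LINT y|lborel. wave (\<omega> \<bullet> y) * (?f (?R *v y) * cnj (?g (?S *v y))))"
      unfolding K_def pair_gauss_def wave_packet_product mult.assoc[symmetric] wave_add[symmetric] \<omega>
      by simp
    also have "\<dots> = matrix_dist A ?f ?g (0, \<omega>)"
      by (simp add: matrix_dist_wave mult.assoc)
    also have "\<dots> = matrix_dist A (\<lambda>t. ?f (t + u)) (\<lambda>t. ?g (t + u)) ((0, \<omega>) - (u, 0))"
      using wigner_translate[of "\<lambda>t. ?f (t + u)" u "\<lambda>t. ?g (t + u)"]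
      by (intro cohen_class_covariant[OF B translated_wave_packet_schwartz translated_wave_packet_schwartz
            wave_packet_schwartz wave_packet_schwartz]) simp
    also have "\<dots> = (LINT y|lborel. wave (\<omega> \<bullet> y) * (?f (?R *v y + p) * cnj (?g (?S *v y + q))))"
      unfolding diff_Pair matrix_dist_wave diff_0 neg mult.assoc by simp
    also have "\<dots> = (LINT y|lborel. wave (q \<bullet> \<eta>' - p \<bullet> \<eta>) * complex_of_real (exp (- ((norm (?R *v y + p))\<^sup>2 + (norm (?S *v y + q))\<^sup>2))))"
      unfolding wave_packet_product mult.assoc[symmetric] wave_add[symmetric] \<omega>
      by (simp add: inner_add_left)
    also have "\<dots> = wave (q \<bullet> \<eta>' - p \<bullet> \<eta>) * K'"
      unfolding K'_def by (rule integral_mult_right_zero)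
    finally show ?thesis .
  qed
  have "K \<noteq> 0"
  proof
    assume "K = 0"
    then have "(LINT y|lborel. pair_gauss ?R ?S y) = 0"
      by (simp add: K_def integral_complex_of_real)
    then have "pair_gauss ?R ?S 0 = 0"
      using block_column_injective[OF A] pair_gauss_pos[THEN less_imp_le]
      by (intro continuous_nonneg_integral_eq_0[OF continuous_on_pair_gauss] integrable_pair_gauss_base)
    with pair_gauss_pos show False by (metis less_irrefl)
  qed
  moreover have "K = K'" using key[of 0 0] by simp
  ultimately have wave: "wave (q \<bullet> \<eta>' - p \<bullet> \<eta>) = 1" for \<eta> \<eta>'
    using key[of \<eta>' \<eta>] by simp
  have "p = 0"
  proof (rule wave_trivial_imp_0)
    show "wave (p \<bullet> \<eta>) = 1" for \<eta> using wave[of 0 "- \<eta>"] by simp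
  qed
  moreover have "q = 0"
  proof (rule wave_trivial_imp_0)
    show "wave (q \<bullet> \<eta>) = 1" for \<eta> using wave[of \<eta> 0] by simp
  qed
  ultimately show "block11 A *v u = u" "block21 A *v u = u" by (simp_all add: p_def q_def)
qed

text \<open>Modulations act on the Wigner distribution by \<open>\<omega> \<mapsto> \<omega> - \<zeta>\<close>. Tested on a Gaussian, covariance says that
  inserting the phase \<open>wave (D \<zeta> y)\<close> does not change the integral of a positive function. Then the phase
  is constantly 1, and the linear map \<open>D \<zeta>\<close> is zero, since otherwise it takes the value 1/2.\<close>

lemma cohen_class_frequency_blocks:
  assumes A: "invertible A" and B: "cohen_class (matrix_dist A)"
  shows "block12 A *v y - block22 A *v y = y"
proof -
  let ?R = "block12 A" and ?S = "block22 A"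
  let ?G = "pair_gauss ?R ?S"
  have G: "integrable lborel ?G"
    using block_column_injective[OF A] by (intro integrable_pair_gauss_base)
  have "D \<zeta> y = 0" if D: "D = (\<lambda>\<zeta> y. \<zeta> \<bullet> (y - (?R *v y - ?S *v y)))" for D \<zeta> y
  proof (rule ccontr)
    assume nz: "D \<zeta> y \<noteq> 0"
    let ?f = "wave_packet \<zeta> 0" and ?g = "wave_packet 0 0"
    have f: "?f = (\<lambda>t. wave (- (t \<bullet> \<zeta>)) * ?g t)"
      by (rule ext) (simp add: wave_packet_def)
    have "(LINT y|lborel. wave (D \<zeta> y) * ?G y) = matrix_dist A ?f ?f (0, \<zeta>)"
      unfolding matrix_dist_wave mult.assoc wave_packet_product
      unfolding mult.assoc[symmetric] wave_add[symmetric]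
      by (simp add: D pair_gauss_def inner_diff_right inner_commute[of _ \<zeta>] inner_add_right diff_diff_eq2 add_diff_eq)
    also have "\<dots> = matrix_dist A ?g ?g ((0, \<zeta>) - (0, \<zeta>))"
      using wigner_modulate[of \<zeta> ?g ?g]
      by (intro cohen_class_covariant[OF B wave_packet_schwartz wave_packet_schwartz
            wave_packet_schwartz wave_packet_schwartz]) (simp only: f)
    also have "\<dots> = (LINT y|lborel. of_real (?G y))"
      unfolding diff_Pair matrix_dist_wave mult.assoc wave_packet_product by (simp add: pair_gauss_def)
    finally have eq: "(LINT y|lborel. wave (D \<zeta> y) * ?G y) = (LINT y|lborel. of_real (?G y))" .
    have contD: "continuous_on UNIV (D \<zeta>)"
      unfolding D by (intro continuous_intros)
    have int: "integrable lborel (\<lambda>y. wave (D \<zeta> y) * ?G y)"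
    proof (rule Bochner_Integration.integrable_bound[OF G])
      show "(\<lambda>y. wave (D \<zeta> y) * ?G y) \<in> borel_measurable lborel"
        using borel_measurable_continuous_onI[OF continuous_on_mult[OF continuous_on_wave[OF contD]
              continuous_on_of_real[OF continuous_on_pair_gauss]]] by simp
    qed (simp add: norm_mult)
    have "(LINT y|lborel. (1 - Re (wave (D \<zeta> y))) * ?G y)
      = (LINT y|lborel. ?G y - Re (wave (D \<zeta> y) * ?G y))"
      by (simp add: algebra_simps)
    also have "\<dots> = (LINT y|lborel. ?G y) - (LINT y|lborel. Re (wave (D \<zeta> y) * ?G y))"
      by (intro Bochner_Integration.integral_diff G integrable_Re int)
    also have "\<dots> = 0"
      unfolding integral_Re[OF int] eq by simp
    finally have zero: "(LINT y|lborel. (1 - Re (wave (D \<zeta> y))) * ?G y) = 0" .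
    \<comment> \<open>Scaling moves the value of the linear form to 1/2, where the kernel is -1.\<close>
    define y' where "y' = (1 / (2 * D \<zeta> y)) *\<^sub>R y"
    have "(1 - Re (wave (D \<zeta> y'))) * ?G y' = 0"
    proof (rule continuous_nonneg_integral_eq_0[OF _ _ _ zero])
      show "continuous_on UNIV (\<lambda>y. (1 - Re (wave (D \<zeta> y))) * ?G y)"
        by (intro continuous_intros continuous_on_pair_gauss contD)
      show "0 \<le> (1 - Re (wave (D \<zeta> y))) * ?G y" for y
        by (simp add: pair_gauss_def Re_wave)
      have "integrable lborel (\<lambda>y. ?G y - Re (wave (D \<zeta> y) * ?G y))"
        by (intro Bochner_Integration.integrable_diff G integrable_Re int)
      then show "integrable lborel (\<lambda>y. (1 - Re (wave (D \<zeta> y))) * ?G y)"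
        by (simp add: algebra_simps)
    qed
    moreover have "D \<zeta> y' = 1 / (2 * D \<zeta> y) * D \<zeta> y"
      by (simp add: D y'_def matrix_vector_mult_scaleR flip: scaleR_diff_right)
    then have "D \<zeta> y' = 1/2" using nz by simp
    ultimately show False by (simp add: wave_half pair_gauss_def)
  qed
  from this[OF refl, of "y - (?R *v y - ?S *v y)" y] show ?thesis by simp
qed

section \<open>Strong support and the characterisation\<close>

text \<open>The Schwartz function \<open>norm t ^ 2 * exp (- norm t ^ 2)\<close> vanishes at the origin only. At the phase space point
  \<open>(0, 0)\<close> its distribution is the integral of a non-negative function, whose vanishing forces one of
  the two arguments of the signal to be the origin for every \<open>y\<close>.\<close>

lemma time_strong_support_blocks:
  fixes A :: "real^('n::finite + 'n)^('n + 'n)"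
  assumes A: "invertible A" and supp: "time_strong_support (\<lambda>f. matrix_dist A f f)"
  shows "block12 A *v y = 0 \<or> block22 A *v y = 0"
proof -
  let ?R = "block12 A" and ?S = "block22 A"
  define f :: "'n signal" where "f t = of_real ((norm t)\<^sup>2) * wave_packet 0 0 t" for t
  have "f \<in> schwartz"
    unfolding f_def by (intro poly_wave_packet_schwartz cpoly_norm_square)
  moreover have "f 0 = 0" by (simp add: f_def)
  ultimately have "matrix_dist A f f (0, 0) = 0"
    using supp unfolding time_strong_support_def by blast
  define F where "F y = (norm (?R *v y))\<^sup>2 * (norm (?S *v y))\<^sup>2 * pair_gauss ?R ?S y" for y
  have "f (?R *v y) * cnj (f (?S *v y)) = of_real (F y)" for y
  proof -
    have "f (?R *v y) * cnj (f (?S *v y)) = of_real ((norm (?R *v y))\<^sup>2 * (norm (?S *v y))\<^sup>2)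
        * (wave_packet 0 0 (?R *v y) * cnj (wave_packet 0 0 (?S *v y)))"
      by (simp add: f_def)
    also have "\<dots> = of_real (F y)"
      unfolding wave_packet_product by (simp add: F_def pair_gauss_def)
    finally show ?thesis .
  qed
  then have "matrix_dist A f f (0, 0) = (LINT y|lborel. of_real (F y))"
    by (simp add: matrix_dist_wave)
  with \<open>matrix_dist A f f (0, 0) = 0\<close> have zero: "(LINT y|lborel. F y) = 0" by simp
  have cont: "continuous_on UNIV F"
    unfolding F_def by (intro continuous_intros continuous_on_pair_gauss)
  have nonneg: "0 \<le> F y" for y
    by (simp add: F_def pair_gauss_def)
  have le: "F y \<le> 4 * pair_gauss ?R ?S y powr (1/2)" for y
  proof -
    define r s where "r = (norm (?R *v y))\<^sup>2" and "s = (norm (?S *v y))\<^sup>2"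
    have "r \<ge> 0" "s \<ge> 0" by (simp_all add: r_def s_def)
    \<comment> \<open>Half of the Gaussian exponent absorbs the quadratic factors.\<close>
    have "r \<le> 2 * exp (r / 2)" "s \<le> 2 * exp (s / 2)"
      using exp_ge_add_one_self[of "r / 2"] exp_ge_add_one_self[of "s / 2"] by linarith+
    then have "r * s \<le> (2 * exp (r / 2)) * (2 * exp (s / 2))"
      using \<open>r \<ge> 0\<close> \<open>s \<ge> 0\<close> by (intro mult_mono) auto
    then have "r * s * exp (- (r + s)) \<le> (2 * exp (r / 2)) * (2 * exp (s / 2)) * exp (- (r + s))"
      by (rule mult_right_mono) simp
    also have "\<dots> = 4 * exp (r / 2 + s / 2 + - (r + s))"
      unfolding exp_add by simp
    also have "\<dots> = 4 * exp (- (r + s)) powr (1/2)"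
      by (simp add: exp_powr_real)
    finally show ?thesis by (simp add: F_def pair_gauss_def r_def s_def)
  qed
  have "integrable lborel F"
  proof (rule Bochner_Integration.integrable_bound)
    show "integrable lborel (\<lambda>y. 4 * pair_gauss ?R ?S y powr (1/2))"
      using block_column_injective[OF A] by (intro integrable_mult_right integrable_pair_gauss) auto
    show "F \<in> borel_measurable lborel"
      using borel_measurable_continuous_onI[OF cont] by simp
    show "AE y in lborel. norm (F y) \<le> norm (4 * pair_gauss ?R ?S y powr (1/2))"
      using le nonneg by (intro AE_I2) simp
  qed
  then have "F y = 0"
    by (rule continuous_nonneg_integral_eq_0[OF cont nonneg _ zero])
  then show ?thesis
    using pair_gauss_pos[of ?R ?S y] by (simp add: F_def)
qed

text \<open>A vector space is not the union of two proper subspaces, here the kernels of \<open>P\<close> and \<open>P - 1\<close>.\<close>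

lemma matrix_eq_0_or_id:
  fixes P :: "real^'n::finite^'n"
  assumes "\<And>y. P *v y = 0 \<or> P *v y = y"
  shows "P = 0 \<or> P = mat 1"
proof (rule ccontr)
  assume "\<not> ?thesis"
  then obtain a b where "P *v a \<noteq> 0" "P *v b \<noteq> b"
    by (metis matrix_eq matrix_vector_mult_0 matrix_vector_mul_lid)
  then have "P *v a = a" "a \<noteq> 0" "P *v b = 0" "b \<noteq> 0"
    using assms[of a] assms[of b] by auto
  then have "P *v (a + b) = a" by (simp add: matrix_vector_right_distrib)
  with assms[of "a + b"] \<open>a \<noteq> 0\<close> \<open>b \<noteq> 0\<close> show False by auto
qed

lemma minus_mat_1_mult: "(- mat 1) *v y = - (y::real^'n::finite)"
  using matrix_vector_mult_diff_rdistrib[of 0 "mat 1" y] by simp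

lemma matrix_dist_cong_blocks:
  assumes "block11 A = block11 A'" "block12 A = block12 A'" "block21 A = block21 A'" "block22 A = block22 A'"
  shows "matrix_dist A = matrix_dist A'"
  by (intro ext) (simp add: matrix_dist_def assms)

lemma cohen_strong_support_imp_rihaczek:
  fixes A :: "real^('n::finite + 'n)^('n + 'n)"
  assumes A: "invertible A" and C: "cohen_class (matrix_dist A)"
    and supp: "time_strong_support (\<lambda>f. matrix_dist A f f)"
  shows "matrix_dist A = rihaczek \<or> matrix_dist A = conj_rihaczek"
proof -
  have 1: "block11 A = mat 1" "block21 A = mat 1"
    using cohen_class_time_blocks[OF A C] by (simp_all add: matrix_eq)
  have diff: "block22 A *v y = block12 A *v y - y" for y
    using cohen_class_frequency_blocks[OF A C, of y] by (simp add: algebra_simps)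
  have "block12 A = 0 \<or> block12 A = mat 1"
    using time_strong_support_blocks[OF A supp] by (intro matrix_eq_0_or_id) (auto simp: diff)
  then show ?thesis
  proof
    assume 12: "block12 A = 0"
    have "block22 A *v y = (- mat 1) *v y" for y
      using diff[of y] by (simp add: 12 minus_mat_1_mult)
    then have "block22 A = - mat 1" by (simp add: matrix_eq)
    then show ?thesis
      unfolding rihaczek_def by (intro disjI1 matrix_dist_cong_blocks) (simp_all add: 1 12)
  next
    assume 12: "block12 A = mat 1"
    have "block22 A = 0" using diff by (simp add: matrix_eq 12)
    then show ?thesis
      unfolding conj_rihaczek_def by (intro disjI2 matrix_dist_cong_blocks) (simp_all add: 1 12)
  qed
qed

lemma block_matrix_mult:
  "block_matrix P Q R S ** block_matrix P' Q' R' S'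
   = block_matrix (P ** P' + Q ** R') (P ** Q' + Q ** S') (R ** P' + S ** R') (R ** Q' + S ** S')"
  unfolding vec_eq_iff
proof (intro allI)
  fix i j
  show "(block_matrix P Q R S ** block_matrix P' Q' R' S') $ i $ j
   = block_matrix (P ** P' + Q ** R') (P ** Q' + Q ** S') (R ** P' + S ** R') (R ** Q' + S ** S') $ i $ j"
    by (cases i; cases j) (simp_all add: block_matrix_def matrix_matrix_mult_def sum_UNIV_sum)
qed

lemma block_matrix_mat_1: "block_matrix (mat 1) 0 0 (mat 1) = mat 1"
  by (auto simp: vec_eq_iff block_matrix_def mat_def split: sum.split)

lemma matrix_minus_mult:
  fixes A :: "real^'n::finite^'m::finite" and B :: "real^'k::finite^'n"
  shows "(- A) ** B = - (A ** B)" "A ** (- B) = - (A ** B)"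
  by (simp_all add: matrix_matrix_mult_def vec_eq_iff sum_negf)

lemma invertible_rihaczek_matrix:
  "invertible (block_matrix (mat 1) 0 (mat 1) (- mat 1 :: real^'n::finite^'n))" (is "invertible ?A")
proof -
  have "?A ** ?A = mat 1"
    unfolding block_matrix_mult matrix_minus_mult block_matrix_mat_1[symmetric] by simp
  then show ?thesis unfolding invertible_def by blast
qed

lemma invertible_conj_rihaczek_matrix:
  "invertible (block_matrix (mat 1) (mat 1) (mat 1) (0 :: real^'n::finite^'n))" (is "invertible ?A")
proof -
  let ?B = "block_matrix 0 (mat 1) (mat 1) (- mat 1 :: real^'n^'n)"
  have "?A ** ?B = mat 1" "?B ** ?A = mat 1"
    unfolding block_matrix_mult matrix_minus_mult block_matrix_mat_1[symmetric] by simp_all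
  then show ?thesis unfolding invertible_def by blast
qed

text \<open>The integral is the \<open>\<tau>\<close>-Wigner distribution with \<open>\<tau> = 1/2 - 1/c\<close>; the values \<open>c = 2\<close> and \<open>c = - 2\<close> are the
  Rihaczek and conjugate-Rihaczek distributions.\<close>

lemma cohen_class_tau_wigner:
  assumes "c \<noteq> 0" and "\<And>f g x \<omega>. B f g (x, \<omega>) =
    (LINT y|lborel. wave (\<omega> \<bullet> y) * f (x + (1/2 - 1/c) *\<^sub>R y) * cnj (g (x - (1/2 + 1/c) *\<^sub>R y)))"
  shows "cohen_class B"
  unfolding cohen_class_def
proof (intro exI conjI ballI ext)
  show "tempered_distribution (chirp_distribution c)" by (rule tempered_chirp_distribution)
  fix f g :: "'a signal" and z
  assume "f \<in> schwartz" "g \<in> schwartz"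
  with assms show "B f g z = conv_distribution (wigner f g) (chirp_distribution c) z"
    by (cases z) (simp add: chirp_distribution_wigner)
qed

lemma cohen_class_rihaczek: "cohen_class rihaczek"
  by (rule cohen_class_tau_wigner[of 2]) (simp_all add: rihaczek_def matrix_dist_wave minus_mat_1_mult)

lemma cohen_class_conj_rihaczek: "cohen_class conj_rihaczek"
  by (rule cohen_class_tau_wigner[of "-2"]) (simp_all add: conj_rihaczek_def matrix_dist_wave)

lemma rihaczek_eq_0_iff:
  assumes "f \<in> schwartz"
  shows "rihaczek f f (x, \<omega>) = 0 \<longleftrightarrow> f x = 0 \<or> fourier f \<omega> = 0"
  by (simp add: rihaczek_eq[OF assms])

lemma conj_rihaczek_eq_cnj: "conj_rihaczek f f z = cnj (rihaczek f f z)"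
proof (cases z)
  case (Pair x \<omega>)
  have "conj_rihaczek f f (x, \<omega>) = (LINT y|lborel. wave (\<omega> \<bullet> y) * f (x + y) * cnj (f x))"
    by (simp add: conj_rihaczek_def matrix_dist_wave)
  also have "\<dots> = (LINT y|lborel. wave (- (\<omega> \<bullet> y)) * f (x - y) * cnj (f x))"
    by (subst lborel_integral_affine[of "-1" _ 0]) simp_all
  also have "\<dots> = (LINT y|lborel. cnj (wave (\<omega> \<bullet> y) * f x * cnj (f (x - y))))"
    by (simp add: cnj_wave ac_simps)
  also have "\<dots> = cnj (LINT y|lborel. wave (\<omega> \<bullet> y) * f x * cnj (f (x - y)))"
    by (rule Bochner_Integration.integral_cnj)
  also have "\<dots> = cnj (rihaczek f f (x, \<omega>))"
    by (simp add: rihaczek_def matrix_dist_wave minus_mat_1_mult)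
  finally show ?thesis by (simp add: Pair)
qed

text \<open>Both nontrivial implications come from Fourier uniqueness: a product \<open>f x * fourier f \<omega>\<close> that
  vanishes for all \<open>\<omega>\<close> has \<open>f x = 0\<close> or \<open>f\<close> with zero transform, and dually for \<open>x\<close>.\<close>

lemma strong_support_if_zeros:
  assumes zeros: "\<And>f x \<omega>. f \<in> schwartz \<Longrightarrow> Q f (x, \<omega>) = 0 \<longleftrightarrow> f x = 0 \<or> fourier f \<omega> = 0"
  shows "strong_support Q"
  unfolding strong_support_def time_strong_support_def frequency_strong_support_def
proof (intro conjI ballI allI)
  fix f :: "'a signal" and x
  assume f: "f \<in> schwartz"
  then have "(\<forall>\<omega>. Q f (x, \<omega>) = 0) \<longleftrightarrow> f x = 0 \<or> (\<forall>\<omega>. fourier f \<omega> = 0)"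
    by (simp add: zeros)
  then show "f x = 0 \<longleftrightarrow> (\<forall>\<omega>. Q f (x, \<omega>) = 0)"
    using fourier_injective[OF f, of x] by argo
next
  fix f :: "'a signal" and \<omega>
  assume f: "f \<in> schwartz"
  then have "(\<forall>x. Q f (x, \<omega>) = 0) \<longleftrightarrow> fourier f \<omega> = 0 \<or> (\<forall>x. f x = 0)"
    by (simp add: zeros disj_commute)
  moreover have "(\<forall>x. f x = 0) \<Longrightarrow> fourier f \<omega> = 0"
    by (simp add: fourier_def)
  ultimately show "fourier f \<omega> = 0 \<longleftrightarrow> (\<forall>x. Q f (x, \<omega>) = 0)" by argo
qed

theorem theorem4p6:
  "{matrix_dist A | A :: real^('n::finite + 'n)^('n + 'n).
      invertible A \<and> cohen_class (matrix_dist A) \<and> strong_support (\<lambda>f. matrix_dist A f f)}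
   = {rihaczek, conj_rihaczek}" (is "?L = _")
proof (intro equalityI subsetI)
  fix B :: "'n signal \<Rightarrow> 'n signal \<Rightarrow> 'n phase_fun"
  assume "B \<in> ?L"
  then obtain A :: "real^('n + 'n)^('n + 'n)" where "B = matrix_dist A" "invertible A"
    "cohen_class (matrix_dist A)" "time_strong_support (\<lambda>f. matrix_dist A f f)"
    by (auto simp: strong_support_def)
  then show "B \<in> {rihaczek, conj_rihaczek}"
    using cohen_strong_support_imp_rihaczek[of A] by simp
next
  fix B :: "'n signal \<Rightarrow> 'n signal \<Rightarrow> 'n phase_fun"
  assume B: "B \<in> {rihaczek, conj_rihaczek}"
  then have "cohen_class B"
    using cohen_class_rihaczek cohen_class_conj_rihaczek by auto
  moreover have "strong_support (\<lambda>f. B f f)"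
    by (rule strong_support_if_zeros) (use B in \<open>auto simp: conj_rihaczek_eq_cnj rihaczek_eq_0_iff\<close>)
  moreover obtain A :: "real^('n + 'n)^('n + 'n)" where "invertible A" "B = matrix_dist A"
    using B invertible_rihaczek_matrix invertible_conj_rihaczek_matrix
    unfolding rihaczek_def conj_rihaczek_def by blast
  ultimately show "B \<in> ?L" by blast
qed

end
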